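(* Let $k\in\mathbb{N}$ and let $n\ge k-1$ be an integer. Let $\pi_k^{(n)}=1^k\times w_0^{(n-k)}\in\mathbb{S}_n$, and let $$\mathcal{T}_n^{(k)}(\beta)=\sum_{\mathcal{E}}\beta^{i(\mathcal{E})},$$ where the sum runs over the set of all $k$-dissections $\mathcal{E}$ of a convex $(n+k+1)$-gon and $i(\mathcal{E})=n(2k-1)-1-\#|\mathcal{E}|$ is the index of $\mathcal{E}$. Then $$\mathfrak{G}^{(\beta)}_{\pi_k^{(n)}}(x_1=1,\dots,x_n=1)=\mathcal{T}_n^{(k)}(\beta).$$
   Context: A $k$-dissection of a convex $(n+k+1)$-gon is a collection $\mathcal{E}$ of diagonals of the $(n+k+1)$-gon which contains no $(k+1)$-subset of pairwise crossing diagonals and is such that at least $2(k-1)$ diagonals of $\mathcal{E}$ come from each vertex of the $(n+k+1)$-gon. $\pi_k^{(n)}=1^k\times w_0^{(n-k)}\in\mathbb{S}_n$ is the permutation $\pi_k^{(n)}(i)=i$ for $1\le i\le k$ and $\pi_k^{(n)}(k+a)=n+1-a$ for $1\le a\le n-k$. $\beta$-Grothendieck polynomials: let $\mathrm{IdC}_m(\beta)$ be the associative $\mathbb{Z}[\beta]$-algebra with generators $e_1,\dots,e_{m-1}$ and relations $e_ie_j=e_je_i$ if $|i-j|\ge2$, $e_ie_je_i=e_je_ie_j$ if $|i-j|=1$, $e_i^2=\beta e_i$. For $w\in\mathbb{S}_m$ put $e_w=e_{i_1}\cdots e_{i_\ell}$ for any reduced word $w=s_{i_1}\cdots s_{i_\ell}$,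 where $s_i=(i,i+1)$. With commuting variables $x_i$ which commute with all $e_j$, $h_i(x)=1+xe_i$ and $A_i(x)=h_{m-1}(x)\cdots h_i(x)$, the polynomials $\mathfrak{G}_w^{(\beta)}$ are defined by $A_1(x_1)\cdots A_{m-1}(x_{m-1})=\sum_{w\in\mathbb{S}_m}\mathfrak{G}_w^{(\beta)}(x_1,\dots,x_{m-1})e_w$.
   Formalization: The permutation is taken as π_k^{(n+1)} in S_{n+1} (literally false for k=1, n=2: 1 vs 2+β); a k-dissection must contain all diagonals of boundary length 2..k, not just any 2(k-1) at each vertex (fails for k=2, n=3); the 2-gon (k=1, n=0) gets index 0, not -1. *)

theory Defs
  imports
    "HOL-Library.Poly_Mapping"
    "HOL-Computational_Algebra.Polynomial"
    "HOL-Combinatorics.Permutations"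
begin

section \<open>The coefficient ring \<open>\<int>[\<beta>][x\<^sub>1, x\<^sub>2, \<dots>]\<close>\<close>

text \<open>\<open>\<int>[\<beta>]\<close> is \<^typ>\<open>int poly\<close>; a monomial in the \<open>x\<^sub>i\<close> is its exponent
  function.\<close>

type_synonym xpoly = "(nat \<Rightarrow>\<^sub>0 nat) \<Rightarrow>\<^sub>0 int poly"

definition beta :: "int poly" where
  "beta = [:0, 1:]"

definition xconst :: "int poly \<Rightarrow> xpoly" where
  "xconst c = Poly_Mapping.single 0 c"

definition xvar :: "nat \<Rightarrow> xpoly" where
  "xvar i = Poly_Mapping.single (Poly_Mapping.single i 1) 1"

definition xeval :: "(nat \<Rightarrow> int poly) \<Rightarrow> xpoly \<Rightarrow> int poly" where
  "xeval a p =
     (\<Sum>t\<in>Poly_Mapping.keys p. Poly_Mapping.lookup p t *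
        (\<Prod>i\<in>Poly_Mapping.keys t. a i ^ Poly_Mapping.lookup t i))"


section \<open>The algebra \<open>IdC\<^sub>m(\<beta>)\<close>\<close>

text \<open>Words form the free monoid, written additively so that the convolution product of
  \<^theory>\<open>HOL-Library.Poly_Mapping\<close> turns the type \<open>free_alg\<close> below into the free
  associative algebra over \<^typ>\<open>xpoly\<close>. Its scalars already contain the \<open>x\<^sub>i\<close>, which therefore
  commute with each other and with all generators.\<close>

datatype word = Word (letters: "nat list")

instantiation word :: monoid_add
begin

definition zero_word :: word where
  "0 = Word []"

definition plus_word :: "word \<Rightarrow> word \<Rightarrow> word" where
  "u + v = Word (letters u @ letters v)"

instance
  by standard (simp_all add: zero_word_def plus_word_def)

end

type_synonym free_alg = "word \<Rightarrow>\<^sub>0 xpoly"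

definition scal :: "xpoly \<Rightarrow> free_alg" where
  "scal c = Poly_Mapping.single 0 c"

definition gen :: "nat \<Rightarrow> free_alg" where
  "gen i = Poly_Mapping.single (Word [i]) 1"

definition idc_relators :: "nat \<Rightarrow> free_alg set" where
  "idc_relators m =
     {gen i * gen j - gen j * gen i | i j.
        i \<in> {1..<m} \<and> j \<in> {1..<m} \<and> (i + 2 \<le> j \<or> j + 2 \<le> i)} \<union>
     {gen i * gen j * gen i - gen j * gen i * gen j | i j.
        i \<in> {1..<m} \<and> j \<in> {1..<m} \<and> (j = i + 1 \<or> i = j + 1)} \<union>
     {gen i * gen i - scal (xconst beta) * gen i | i. i \<in> {1..<m}}"

inductive_set two_sided_ideal :: "'a::ring_1 set \<Rightarrow> 'a set" for S :: "'a set" where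
  zero: "0 \<in> two_sided_ideal S"
| gen: "s \<in> S \<Longrightarrow> a * s * b \<in> two_sided_ideal S"
| add: "x \<in> two_sided_ideal S \<Longrightarrow> y \<in> two_sided_ideal S \<Longrightarrow> x + y \<in> two_sided_ideal S"

text \<open>Equality in \<open>IdC\<^sub>m(\<beta>)\<close>, with scalars extended to \<^typ>\<open>xpoly\<close>, of elements of the
  free algebra.\<close>

definition idc_eq :: "nat \<Rightarrow> free_alg \<Rightarrow> free_alg \<Rightarrow> bool" where
  "idc_eq m a b \<longleftrightarrow> a - b \<in> two_sided_ideal (idc_relators m)"


section \<open>\<open>\<beta>\<close>-Grothendieck polynomials\<close>

text \<open>\<open>\<S>\<^sub>m\<close> is the set of functions \<^term>\<open>w\<close> with \<^term>\<open>w permutes {1..m}\<close>.\<close>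

definition word_perm :: "nat list \<Rightarrow> nat \<Rightarrow> nat" where
  "word_perm is = foldr (\<lambda>i w. transpose i (Suc i) \<circ> w) is id"

definition is_reduced_word :: "nat \<Rightarrow> (nat \<Rightarrow> nat) \<Rightarrow> nat list \<Rightarrow> bool" where
  "is_reduced_word m w is \<longleftrightarrow>
     set is \<subseteq> {1..<m} \<and> word_perm is = w \<and>
     (\<forall>js. set js \<subseteq> {1..<m} \<and> word_perm js = w \<longrightarrow> length is \<le> length js)"

text \<open>Modulo \<^const>\<open>idc_eq\<close>, the choice of the reduced word is immaterial.\<close>

definition gen_perm :: "nat \<Rightarrow> (nat \<Rightarrow> nat) \<Rightarrow> free_alg" where
  "gen_perm m w = prod_list (map gen (SOME is. is_reduced_word m w is))"

definition h_fac :: "nat \<Rightarrow> xpoly \<Rightarrow> free_alg" where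
  "h_fac i x = 1 + scal x * gen i"

definition A_fac :: "nat \<Rightarrow> nat \<Rightarrow> xpoly \<Rightarrow> free_alg" where
  "A_fac m i x = prod_list (map (\<lambda>j. h_fac j x) (rev [i..<m]))"

definition is_groth_family :: "nat \<Rightarrow> ((nat \<Rightarrow> nat) \<Rightarrow> xpoly) \<Rightarrow> bool" where
  "is_groth_family m G \<longleftrightarrow>
     idc_eq m (prod_list (map (\<lambda>i. A_fac m i (xvar i)) [1..<m]))
              (\<Sum>w | w permutes {1..m}. scal (G w) * gen_perm m w)"

text \<open>The elements \<open>e\<^sub>w\<close> form a basis of \<open>IdC\<^sub>m(\<beta>)\<close>, so the coefficient of \<open>e\<^sub>w\<close> exists
  and is unique for every \<^term>\<open>w\<close> with \<^term>\<open>w permutes {1..m}\<close>.\<close>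

definition grothendieck :: "nat \<Rightarrow> (nat \<Rightarrow> nat) \<Rightarrow> xpoly" where
  "grothendieck m w = (THE p. \<exists>G. is_groth_family m G \<and> G w = p)"

text \<open>\<open>1\<^sup>k \<times> w\<^sub>0\<^sup>(\<^sup>n\<^sup>-\<^sup>k\<^sup>) \<in> \<S>\<^sub>n\<close>: it maps \<open>k + a\<close> to \<open>n + 1 - a\<close> for \<open>1 \<le> a \<le> n - k\<close>.
  The dissections of the \<open>(n + k + 1)\<close>-gon below correspond to this permutation in
  \<open>\<S>\<^sub>n\<^sub>+\<^sub>1\<close>, whose Grothendieck polynomial has the \<open>n\<close> variables \<open>x\<^sub>1, \<dots>, x\<^sub>n\<close>. In \<open>\<S>\<^sub>n\<close> the identity
  fails: for \<open>k = 1\<close> and \<open>n = 2\<close> the permutation is trivial, but a \<open>4\<close>-gon has three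
  dissections.\<close>

definition pi_perm :: "nat \<Rightarrow> nat \<Rightarrow> nat \<Rightarrow> nat" where
  "pi_perm k n i = (if k < i \<and> i \<le> n then n + 1 - (i - k) else i)"


section \<open>Dissections\<close>

text \<open>The vertices of a convex \<open>N\<close>-gon are \<open>0, \<dots>, N - 1\<close> in cyclic order. The distance of two
  vertices is measured along the boundary, so that sides have length 1 and diagonals have
  length at least 2.\<close>

definition bdist :: "nat \<Rightarrow> nat \<Rightarrow> nat \<Rightarrow> nat" where
  "bdist N i j = (let d = (if i \<le> j then j - i else i - j) in min d (N - d))"

definition diagonals :: "nat \<Rightarrow> nat set set" where
  "diagonals N = {{i, j} | i j. i < N \<and> j < N \<and> 2 \<le> bdist N i j}"

definition crosses :: "nat set \<Rightarrow> nat set \<Rightarrow> bool" where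
  "crosses d d' \<longleftrightarrow> (\<exists>a b c e. a < b \<and> b < c \<and> c < e \<and>
     (d = {a, c} \<and> d' = {b, e} \<or> d = {b, e} \<and> d' = {a, c}))"

text \<open>The last condition says that \<^term>\<open>E\<close> contains, at each vertex \<open>v\<close>, the diagonals to
  the vertices at distance \<open>2, \<dots>, k\<close> on either side of \<open>v\<close>. For \<open>N > 2 k\<close> these are exactly
  \<open>2 (k - 1)\<close> diagonals at \<open>v\<close>, and they are the ones which lie in no set of \<open>k + 1\<close> pairwise
  crossing diagonals. Merely asking for \<open>2 (k - 1)\<close> arbitrary diagonals of \<^term>\<open>E\<close> at each
  vertex would admit further sets: for \<open>k = 2\<close> and \<open>N = 6\<close>, one can remove the short diagonal
  \<open>{0, 2}\<close> from the set of all short diagonals and add \<open>{0, 3}\<close> and \<open>{2, 5}\<close>.\<close>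

definition k_dissections :: "nat \<Rightarrow> nat \<Rightarrow> nat set set set" where
  "k_dissections k N = {E. E \<subseteq> diagonals N \<and>
     \<not> (\<exists>C\<subseteq>E. card C = k + 1 \<and> pairwise crosses C) \<and>
     (\<forall>v<N. \<forall>u<N. 2 \<le> bdist N v u \<and> bdist N v u \<le> k \<longrightarrow> {v, u} \<in> E)}"

text \<open>For \<open>n \<ge> 1\<close> and \<open>N = n + k + 1\<close>, a \<open>k\<close>-dissection has at most \<open>n (2 k - 1) - 1\<close> elements,
  so the subtractions below do not truncate. The one exception is the degenerate \<open>2\<close>-gon
  \<open>n = 0\<close>, \<open>k = 1\<close>, whose only dissection is empty and gets index \<open>0\<close> instead of \<open>- 1\<close>.\<close>

definition dissection_index :: "nat \<Rightarrow> nat \<Rightarrow> nat set set \<Rightarrow> nat" where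
  "dissection_index k n E = n * (2 * k - 1) - 1 - card E"

definition T_poly :: "nat \<Rightarrow> nat \<Rightarrow> int poly" where
  "T_poly k n = (\<Sum>E\<in>k_dissections k (n + k + 1). beta ^ dissection_index k n E)"

end

theory Submission
  imports Defs
begin

text \<open>
  Write \<open>m = n + 1\<close>, \<open>N = n + k + 1\<close> and \<open>\<pi> = 1\<^sup>k \<times> w\<^sub>0 \<in> \<S>\<^sub>m\<close>.

  In \<open>IdC\<^sub>m(\<beta>)\<close> every word \<open>u\<close> equals \<open>\<beta>\<^sup>r e\<^sub>w\<close>, where \<open>w\<close> is the Demazure product of \<open>u\<close> and \<open>r\<close> is
  the length of \<open>u\<close> minus the length of \<open>w\<close> (\<open>idc_eq_word\<close>, which rests on Matsumoto's theorem,
  \<open>reduced_words_eq\<close>). The Demazure product also yields linear functionals \<open>dem_coeff w\<close> that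
  vanish on the relations and are dual to the \<open>e\<^sub>w\<close>. So the Grothendieck polynomials exist and are
  unique, and expanding \<open>A\<^sub>1(x\<^sub>1) \<cdots> A\<^sub>m\<^sub>-\<^sub>1(x\<^sub>m\<^sub>-\<^sub>1)\<close> expresses their value at \<open>x\<^sub>i = 1\<close> as the sum of
  \<open>\<beta>\<^bsup>|S| - \<ell>(w)\<^esup>\<close> over the sets \<open>S\<close> of factors whose letters have the Demazure product \<open>w\<close>
  (\<open>xeval_grothendieck\<close>).

  The factor with the letter \<open>t\<close> in \<open>A\<^sub>i\<close> is matched with the chord of the \<open>N\<close>-gon between the
  vertices \<open>i - 1\<close> and \<open>i - 1 + N - t\<close>. The factors with \<open>t > k\<close> then correspond to the diagonals of
  length greater than \<open>k\<close>, and \<open>S\<close> is sent to the set \<open>E\<close> of all diagonals that do not come from \<open>S\<close>.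
  What remains is that \<open>S\<close> has the Demazure product \<open>\<pi>\<close> if and only if its letters are greater than \<open>k\<close>
  and \<open>E\<close> contains no \<open>k + 1\<close> pairwise crossing diagonals.

  To see this, consider the ranks \<open>R(x) = #{a \<le> x. v a > y}\<close> of a permutation \<open>v\<close>, for a fixed
  threshold \<open>y\<close>. A letter \<open>t\<close> replaces \<open>R(t)\<close> by \<open>min (R(t - 1) + 1) (R(t + 1))\<close>. Reading the word row
  by row, this is the recursion for the longest common subsequence in disguise: \<open>x - R(x)\<close> becomes
  the length of the longest chain, increasing strictly in both coordinates, among the pairs
  \<open>(a, b)\<close> with \<open>a < x \<le> b < N\<close> whose chord does not come from \<open>S\<close>, if \<open>y = N - x\<close>
  (\<open>rk_row_state\<close>, \<open>rk_demazure_subword\<close>). Such a chain is the same as a family of pairwise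
  crossing chords that join the vertices below \<open>x\<close> to the others. Finally, among the permutations
  that fix \<open>1, \<dots>, k\<close>, \<open>\<pi>\<close> is characterised by the inequalities \<open>R(x) \<ge> x - k\<close> for \<open>k < x < m\<close> and
  \<open>y = N - x\<close> (\<open>eq_pi_iff\<close>), that is, by the absence of chains of length \<open>k + 1\<close>.
\<close>

section \<open>Linear extension of maps on a basis\<close>

text \<open>The linear functional on finitely supported maps that takes the value \<open>\<kappa> u\<close> at the basis element \<open>u\<close>.\<close>
definition lin_ext :: "('a \<Rightarrow> 'b) \<Rightarrow> ('a \<Rightarrow>\<^sub>0 'b::comm_ring_1) \<Rightarrow> 'b" where
  "lin_ext \<kappa> f = (\<Sum>u\<in>Poly_Mapping.keys f. Poly_Mapping.lookup f u * \<kappa> u)"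

lemma lin_ext_superset:
  assumes "finite A" "Poly_Mapping.keys f \<subseteq> A"
  shows "lin_ext \<kappa> f = (\<Sum>u\<in>A. Poly_Mapping.lookup f u * \<kappa> u)"
  unfolding lin_ext_def using assms by (intro sum.mono_neutral_left) (auto simp: in_keys_iff)

lemma lin_ext_zero [simp]: "lin_ext \<kappa> 0 = 0"
  by (simp add: lin_ext_def)

lemma lin_ext_add: "lin_ext \<kappa> (f + g) = lin_ext \<kappa> f + lin_ext \<kappa> g"
proof -
  let ?A = "Poly_Mapping.keys f \<union> Poly_Mapping.keys g"
  have "lin_ext \<kappa> (f + g) = (\<Sum>u\<in>?A. Poly_Mapping.lookup (f + g) u * \<kappa> u)"
    by (rule lin_ext_superset) (simp_all add: keys_add)
  also have "\<dots> = lin_ext \<kappa> f + lin_ext \<kappa> g"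
    by (simp add: lin_ext_superset[of ?A] lookup_add distrib_right sum.distrib)
  finally show ?thesis .
qed

lemma lin_ext_uminus: "lin_ext \<kappa> (- f) = - lin_ext \<kappa> f"
  using lin_ext_add[of \<kappa> f "- f"] by (simp add: eq_neg_iff_add_eq_0 add.commute)

lemma lin_ext_diff: "lin_ext \<kappa> (f - g) = lin_ext \<kappa> f - lin_ext \<kappa> g"
  using lin_ext_add[of \<kappa> f "- g"] by (simp add: lin_ext_uminus)

lemma lin_ext_sum: "lin_ext \<kappa> (\<Sum>i\<in>I. f i) = (\<Sum>i\<in>I. lin_ext \<kappa> (f i))"
  by (induction I rule: infinite_finite_induct) (simp_all add: lin_ext_add)

lemma lin_ext_single [simp]: "lin_ext \<kappa> (Poly_Mapping.single u c) = c * \<kappa> u"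
  by (simp add: lin_ext_superset[of "{u}"])

lemma sum_singles:
  fixes f :: "'a \<Rightarrow>\<^sub>0 'b::comm_monoid_add"
  shows "(\<Sum>u\<in>Poly_Mapping.keys f. Poly_Mapping.single u (Poly_Mapping.lookup f u)) = f"
proof (rule poly_mapping_eqI)
  fix v
  show "Poly_Mapping.lookup (\<Sum>u\<in>Poly_Mapping.keys f. Poly_Mapping.single u (Poly_Mapping.lookup f u)) v
      = Poly_Mapping.lookup f v"
    by (simp add: lookup_sum lookup_single when_def sum.delta in_keys_iff)
qed

lemma lin_ext_mult:
  fixes f g :: "'a::monoid_add \<Rightarrow>\<^sub>0 'b::comm_ring_1"
  shows "lin_ext \<kappa> (f * g) = (\<Sum>u\<in>Poly_Mapping.keys f. \<Sum>v\<in>Poly_Mapping.keys g.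
    Poly_Mapping.lookup f u * Poly_Mapping.lookup g v * \<kappa> (u + v))"
proof -
  have "lin_ext \<kappa> (f * g) = lin_ext \<kappa>
    ((\<Sum>u\<in>Poly_Mapping.keys f. Poly_Mapping.single u (Poly_Mapping.lookup f u)) *
     (\<Sum>v\<in>Poly_Mapping.keys g. Poly_Mapping.single v (Poly_Mapping.lookup g v)))"
    by (simp add: sum_singles)
  also have "\<dots> = (\<Sum>u\<in>Poly_Mapping.keys f. \<Sum>v\<in>Poly_Mapping.keys g.
    Poly_Mapping.lookup f u * Poly_Mapping.lookup g v * \<kappa> (u + v))"
    by (simp add: sum_product lin_ext_sum mult_single)
  finally show ?thesis .
qed

lemma lin_ext_mult_hom:
  fixes f g :: "'a::monoid_add \<Rightarrow>\<^sub>0 'b::comm_ring_1"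
  assumes "\<And>u v. \<kappa> (u + v) = \<kappa> u * \<kappa> v"
  shows "lin_ext \<kappa> (f * g) = lin_ext \<kappa> f * lin_ext \<kappa> g"
  unfolding lin_ext_mult assms by (simp add: sum_product lin_ext_def mult_ac)

lemma lin_ext_sandwich:
  fixes f g :: "'a::monoid_add \<Rightarrow>\<^sub>0 'b::comm_ring_1"
  shows "lin_ext \<kappa> (f * Poly_Mapping.single p c * g) =
    (\<Sum>u\<in>Poly_Mapping.keys f. \<Sum>v\<in>Poly_Mapping.keys g.
      Poly_Mapping.lookup f u * Poly_Mapping.lookup g v * (c * \<kappa> (u + p + v)))"
proof -
  have "lin_ext \<kappa> (f * Poly_Mapping.single p c * g) = lin_ext \<kappa>
    ((\<Sum>u\<in>Poly_Mapping.keys f. Poly_Mapping.single u (Poly_Mapping.lookup f u)) * Poly_Mapping.single p c *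
     (\<Sum>v\<in>Poly_Mapping.keys g. Poly_Mapping.single v (Poly_Mapping.lookup g v)))"
    by (simp add: sum_singles)
  also have "\<dots> = (\<Sum>u\<in>Poly_Mapping.keys f. \<Sum>v\<in>Poly_Mapping.keys g.
      Poly_Mapping.lookup f u * Poly_Mapping.lookup g v * (c * \<kappa> (u + p + v)))"
    by (simp add: sum_distrib_right sum_distrib_left lin_ext_sum mult_single mult_ac sum.swap[of _ "Poly_Mapping.keys f"])
  finally show ?thesis .
qed

lemma xeval_one: "xeval (\<lambda>_. 1) p = lin_ext (\<lambda>_. 1) p"
  by (simp add: xeval_def lin_ext_def)

section \<open>Congruence in \<open>IdC\<^sub>m(\<beta>)\<close>\<close>

lemma two_sided_ideal_mult:
  "x \<in> two_sided_ideal S \<Longrightarrow> a * x * b \<in> two_sided_ideal S"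
proof (induction rule: two_sided_ideal.induct)
  case zero
  show ?case by (simp add: two_sided_ideal.zero)
next
  case (gen s a' b')
  have "(a * a') * s * (b' * b) \<in> two_sided_ideal S"
    by (rule two_sided_ideal.gen) fact
  then show ?case by (simp add: mult.assoc)
next
  case (add x y)
  then show ?case by (simp add: distrib_left distrib_right two_sided_ideal.add)
qed

lemma two_sided_ideal_uminus: "x \<in> two_sided_ideal S \<Longrightarrow> - x \<in> two_sided_ideal S"
  using two_sided_ideal_mult[of x S "- 1" 1] by simp

lemma idc_eq_refl [simp]: "idc_eq m a a"
  by (simp add: idc_eq_def two_sided_ideal.zero)

lemma idc_eq_sym: "idc_eq m a b \<Longrightarrow> idc_eq m b a"
  unfolding idc_eq_def using two_sided_ideal_uminus[of "a - b"] by simp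

lemma idc_eq_trans [trans]: "idc_eq m a b \<Longrightarrow> idc_eq m b c \<Longrightarrow> idc_eq m a c"
  unfolding idc_eq_def using two_sided_ideal.add[of "a - b" _ "b - c"] by simp

lemma idc_eq_add: "idc_eq m a b \<Longrightarrow> idc_eq m c d \<Longrightarrow> idc_eq m (a + c) (b + d)"
  unfolding idc_eq_def using two_sided_ideal.add[of "a - b" _ "c - d"] by (simp add: algebra_simps)

lemma idc_eq_sum: "(\<And>i. i \<in> I \<Longrightarrow> idc_eq m (f i) (g i)) \<Longrightarrow> idc_eq m (sum f I) (sum g I)"
  by (induction I rule: infinite_finite_induct) (simp_all add: idc_eq_add)

lemma idc_eq_mult: "idc_eq m a b \<Longrightarrow> idc_eq m (c * a * d) (c * b * d)"
  unfolding idc_eq_def using two_sided_ideal_mult[of "a - b" _ c d]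
  by (simp add: algebra_simps)

lemma idc_eq_mult_left: "idc_eq m a b \<Longrightarrow> idc_eq m (c * a) (c * b)"
  using idc_eq_mult[of m a b c 1] by simp

lemma idc_eq_mult_right: "idc_eq m a b \<Longrightarrow> idc_eq m (a * d) (b * d)"
  using idc_eq_mult[of m a b 1 d] by simp

lemma idc_eq_relator: "a - b \<in> idc_relators m \<Longrightarrow> idc_eq m a b"
  unfolding idc_eq_def using two_sided_ideal.gen[of "a - b" _ 1 1] by simp

lemma idc_eq_commute:
  "\<lbrakk>i \<in> {1..<m}; j \<in> {1..<m}; i + 2 \<le> j \<or> j + 2 \<le> i\<rbrakk> \<Longrightarrow> idc_eq m (gen i * gen j) (gen j * gen i)"
  by (rule idc_eq_relator) (auto simp: idc_relators_def)

lemma idc_eq_braid: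
  "\<lbrakk>i \<in> {1..<m}; j \<in> {1..<m}; j = i + 1 \<or> i = j + 1\<rbrakk>
    \<Longrightarrow> idc_eq m (gen i * gen j * gen i) (gen j * gen i * gen j)"
  by (rule idc_eq_relator) (unfold idc_relators_def, blast)

lemma idc_eq_square:
  "i \<in> {1..<m} \<Longrightarrow> idc_eq m (gen i * gen i) (scal (xconst beta) * gen i)"
  by (rule idc_eq_relator) (auto simp: idc_relators_def)

lemma scal_commute: "scal c * a = a * scal c"
proof -
  have "scal c * (\<Sum>u\<in>Poly_Mapping.keys a. Poly_Mapping.single u (Poly_Mapping.lookup a u))
      = (\<Sum>u\<in>Poly_Mapping.keys a. Poly_Mapping.single u (Poly_Mapping.lookup a u)) * scal c"
    by (simp add: scal_def sum_distrib_left sum_distrib_right mult_single mult.commute)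
  then show ?thesis by (simp add: sum_singles)
qed

text \<open>Scalars are central, so they can be moved out of any product.\<close>
lemma mult_scal_left: "a * (scal c * b) = scal c * (a * b)"
  by (simp only: mult.assoc[symmetric] scal_commute[of c a])

lemma scal_mult: "scal (c * d) = scal c * scal d"
  by (simp add: scal_def mult_single)

lemma scal_add: "scal (c + d) = scal c + scal d"
  by (simp add: scal_def single_add)

lemma scal_sum: "scal (sum f I) = (\<Sum>i\<in>I. scal (f i))"
  proof -
  have "scal 0 = 0" by (simp add: scal_def)
  then show ?thesis by (induction I rule: infinite_finite_induct) (simp_all add: scal_add)
qed

lemma scal_one [simp]: "scal 1 = 1"
  by (simp add: scal_def)

lemma prod_gen: "prod_list (map gen us) = Poly_Mapping.single (Word us) 1"
proof (induction us)
  case Nil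
  show ?case by (metis list.simps(8) prod_list.Nil single_one zero_word_def)
next
  case (Cons t us)
  then show ?case by (simp add: gen_def mult_single plus_word_def)
qed


section \<open>Inversions\<close>

text \<open>Inversions are pairs of positions. They are taken over all natural numbers, so that no
  ambient symmetric group has to be carried along; for a permutation of \<open>{1..m}\<close> they are
  finitely many.\<close>
definition inversions :: "(nat \<Rightarrow> nat) \<Rightarrow> (nat \<times> nat) set" where
  "inversions v = {(a, b). a < b \<and> v b < v a}"

text \<open>The length of a permutation.\<close>
definition ell :: "(nat \<Rightarrow> nat) \<Rightarrow> nat" where
  "ell v = card (inversions v)"

text \<open>The simple reflection \<open>s\<^sub>t = (t, t + 1)\<close>. Multiplication by it on the right swaps
  the values at the positions \<open>t\<close> and \<open>t + 1\<close>.\<close>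
abbreviation adj :: "nat \<Rightarrow> nat \<Rightarrow> nat" where
  "adj t \<equiv> transpose t (Suc t)"

lemma adj_adj: "v \<circ> adj t \<circ> adj t = v"
  by (simp add: comp_assoc)

lemma comp_adj_cancel: "v \<circ> adj t = w \<Longrightarrow> v = w \<circ> adj t"
  using adj_adj by metis

lemma inversions_comp_adj:
  assumes "v t < v (Suc t)"
  shows "inversions (v \<circ> adj t) = insert (t, Suc t) ((\<lambda>(a, b). (adj t a, adj t b)) ` inversions v)"
proof (intro equalityI subsetI)
  fix z assume "z \<in> inversions (v \<circ> adj t)"
  then obtain a b where z: "z = (a, b)" "a < b" "v (adj t b) < v (adj t a)"
    by (auto simp: inversions_def)
  show "z \<in> insert (t, Suc t) ((\<lambda>(a, b). (adj t a, adj t b)) ` inversions v)"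
  proof (cases "a = t \<and> b = Suc t")
    case False
    then have "adj t a < adj t b" using z(2)
      by (auto simp: transpose_def)
    then have "(adj t a, adj t b) \<in> inversions v" using z by (auto simp: inversions_def)
    then show ?thesis unfolding z(1) by (intro insertI2 image_eqI[where x = "(adj t a, adj t b)"]) auto
  qed (use z in auto)
next
  fix z assume "z \<in> insert (t, Suc t) ((\<lambda>(a, b). (adj t a, adj t b)) ` inversions v)"
  then consider "z = (t, Suc t)" | a b where "z = (adj t a, adj t b)" "a < b" "v b < v a"
    by (auto simp: inversions_def)
  then show "z \<in> inversions (v \<circ> adj t)"
  proof cases
    case 1
    then show ?thesis using assms by (simp add: inversions_def)
  next
    case 2
    then have "\<not> (a = t \<and> b = Suc t)" using assms by auto
    then have "adj t a < adj t b" using 2 by (auto simp: transpose_def)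
    then show ?thesis using 2 by (simp add: inversions_def)
  qed
qed

lemma ell_ascent:
  assumes "v t < v (Suc t)" "finite (inversions v)"
  shows "finite (inversions (v \<circ> adj t))" "ell (v \<circ> adj t) = Suc (ell v)"
proof -
  let ?f = "\<lambda>(a, b). (adj t a, adj t b)"
  have inj: "inj ?f"
    by (rule inj_on_inverseI[where g = ?f]) auto
  have "(t, Suc t) \<notin> ?f ` inversions v"
  proof
    assume "(t, Suc t) \<in> ?f ` inversions v"
    then obtain a b where "a < b" "adj t a = t" "adj t b = Suc t" by (auto simp: inversions_def)
    then show False by (auto simp: transpose_def split: if_splits)
  qed
  moreover have "card (?f ` inversions v) = card (inversions v)"
    by (intro card_image inj_on_subset[OF inj]) auto
  ultimately show "ell (v \<circ> adj t) = Suc (ell v)"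
    using assms by (simp add: ell_def inversions_comp_adj)
  show "finite (inversions (v \<circ> adj t))" using assms by (simp add: inversions_comp_adj)
qed

lemma inversions_id [simp]: "inversions id = {}"
  by (auto simp: inversions_def)

lemma ell_id [simp]: "ell id = 0"
  by (simp add: ell_def)

lemma finite_inversions:
  assumes "w permutes {1..m}"
  shows "finite (inversions w)"
proof (rule finite_subset)
  show "inversions w \<subseteq> {1..m} \<times> {1..m}"
  proof (clarify)
    fix a b assume "(a, b) \<in> inversions w"
    then have ab: "a < b" "w b < w a" by (auto simp: inversions_def)
    have b: "b \<in> {1..m}"
    proof (rule ccontr)
      assume "b \<notin> {1..m}"
      then have "w b = b" "b > m" using assms ab by (auto simp: permutes_not_in)
      moreover have "w a \<le> max a m"
        using permutes_in_image[OF assms, of a] permutes_not_in[OF assms, of a] by (cases "a \<in> {1..m}") auto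
      ultimately show False using ab by auto
    qed
    have "w a = a \<Longrightarrow> a = 0 \<Longrightarrow> False" using ab by simp
    then have "a \<in> {1..m}" using permutes_not_in[OF assms, of a] b ab by (cases "a = 0") auto
    with b show "a \<in> {1..m} \<and> b \<in> {1..m}" by simp
  qed
qed simp

lemma adj_permutes: "t \<in> {1..<m} \<Longrightarrow> adj t permutes {1..m}"
  by (rule permutes_swap_id) auto

lemma comp_adj_permutes: "w permutes {1..m} \<Longrightarrow> t \<in> {1..<m} \<Longrightarrow> w \<circ> adj t permutes {1..m}"
  by (rule permutes_compose[OF adj_permutes])

lemma ell_descent:
  assumes "w permutes {1..m}" "t \<in> {1..<m}" "\<not> w t < w (Suc t)"
  shows "ell w = Suc (ell (w \<circ> adj t))"
proof -
  have "w t \<noteq> w (Suc t)" using permutes_inj[OF assms(1)] by (simp add: inj_eq)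
  then have "(w \<circ> adj t) t < (w \<circ> adj t) (Suc t)" using assms(3) by simp
  from ell_ascent(2)[OF this finite_inversions[OF comp_adj_permutes[OF assms(1,2)]]]
  show ?thesis by (simp add: adj_adj)
qed

lemma ell_comp_adj_le:
  assumes "w permutes {1..m}" "t \<in> {1..<m}"
  shows "ell (w \<circ> adj t) \<le> Suc (ell w)"
  using ell_descent[OF assms] ell_ascent(2)[OF _ finite_inversions[OF assms(1)], of t]
  by (cases "w t < w (Suc t)") auto

lemma no_descent_id:
  assumes "w permutes {1..m}" "\<And>t. t \<in> {1..<m} \<Longrightarrow> w t < w (Suc t)"
  shows "w = id"
proof (rule permutes_natset_ge[OF assms(1)], rule)
  fix i assume "i \<in> {1..m}"
  then have "1 \<le> i" "i \<le> m" by auto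
  then show "i \<le> w i"
  proof (induction i rule: dec_induct)
    case base
    then show ?case using permutes_in_image[OF assms(1), of 1] by auto
  next
    case (step t)
    then show ?case using assms(2)[of t] by auto
  qed
qed

section \<open>Reduced words\<close>

lemma word_perm_Nil [simp]: "word_perm [] = id"
  by (simp add: word_perm_def)

lemma word_perm_append: "word_perm (us @ vs) = word_perm us \<circ> word_perm vs"
proof (induction us)
  case (Cons t us)
  then show ?case by (simp add: word_perm_def comp_assoc)
qed simp

lemma word_perm_snoc: "word_perm (us @ [t]) = word_perm us \<circ> adj t"
  unfolding word_perm_append by (simp add: word_perm_def)

lemma word_perm_permutes: "set us \<subseteq> {1..<m} \<Longrightarrow> word_perm us permutes {1..m}"
proof (induction us rule: rev_induct)
  case (snoc t us)
  then have "word_perm us \<circ> adj t permutes {1..m}" by (intro comp_adj_permutes) auto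
  then show ?case unfolding word_perm_snoc .
qed (simp add: permutes_id)

lemma ell_word_perm_le: "set us \<subseteq> {1..<m} \<Longrightarrow> ell (word_perm us) \<le> length us"
proof (induction us rule: rev_induct)
  case (snoc t us)
  then have "ell (word_perm us \<circ> adj t) \<le> Suc (ell (word_perm us))"
    by (intro ell_comp_adj_le[OF word_perm_permutes]) auto
  moreover have "ell (word_perm us) \<le> length us" using snoc by auto
  ultimately show ?case unfolding word_perm_snoc length_append_singleton by linarith
qed simp

lemma ex_word:
  assumes "w permutes {1..m}"
  shows "\<exists>us. set us \<subseteq> {1..<m} \<and> word_perm us = w \<and> length us = ell w"
  using assms
proof (induction "ell w" arbitrary: w rule: less_induct)
  case less
  show ?case
  proof (cases "w = id")
    case True
    then show ?thesis by (intro exI[of _ "[]"]) simp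
  next
    case False
    then obtain t where t: "t \<in> {1..<m}" "\<not> w t < w (Suc t)" using no_descent_id less.prems by blast
    note l = ell_descent[OF less.prems t]
    then obtain us where "set us \<subseteq> {1..<m}" "word_perm us = w \<circ> adj t" "length us = ell (w \<circ> adj t)"
      using less.hyps[of "w \<circ> adj t"] comp_adj_permutes[OF less.prems t(1)] by auto
    then show ?thesis using t l by (intro exI[of _ "us @ [t]"]) (simp add: adj_adj word_perm_snoc)
  qed
qed

lemma is_reduced_word_iff:
  assumes "w permutes {1..m}"
  shows "is_reduced_word m w us \<longleftrightarrow> set us \<subseteq> {1..<m} \<and> word_perm us = w \<and> length us = ell w"
  unfolding is_reduced_word_def using ex_word[OF assms] ell_word_perm_le
  by (metis le_antisym)

lemma reduced_snocD:
  assumes "set (us @ [i]) \<subseteq> {1..<m}" "word_perm (us @ [i]) = w" "length (us @ [i]) = ell w"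
  shows "word_perm us = w \<circ> adj i" "length us = ell (w \<circ> adj i)" "\<not> w i < w (Suc i)"
proof -
  show *: "word_perm us = w \<circ> adj i" using comp_adj_cancel[OF assms(2)[unfolded word_perm_snoc]] .
  have w: "w permutes {1..m}" using word_perm_permutes[OF assms(1)] assms(2) by simp
  have le: "ell (w \<circ> adj i) \<le> length us" using ell_word_perm_le[of us m] assms(1) * by simp
  show nd: "\<not> w i < w (Suc i)"
    using ell_ascent(2)[OF _ finite_inversions[OF w], of i] le assms(3) by auto
  show "length us = ell (w \<circ> adj i)"
    using ell_descent[OF w _ nd] assms by simp
qed

lemma braid_perm: "v \<circ> adj i \<circ> adj (Suc i) \<circ> adj i = v \<circ> adj (Suc i) \<circ> adj i \<circ> adj (Suc i)"
  by (auto simp: fun_eq_iff transpose_def)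

lemma commute_perm: "i + 2 \<le> j \<Longrightarrow> v \<circ> adj i \<circ> adj j = v \<circ> adj j \<circ> adj i"
  by (auto simp: fun_eq_iff transpose_def)

text \<open>The monomial of a word in the generators.\<close>
abbreviation gens :: "nat list \<Rightarrow> free_alg" where
  "gens us \<equiv> prod_list (map gen us)"

text \<open>Matsumoto's theorem, in the form needed: two reduced words of \<open>w\<close> give the same element
  of \<open>IdC\<^sub>m(\<beta>)\<close>. If the words end in \<open>i \<noteq> j\<close>, then \<open>w\<close> has descents at both positions, hence
  also reduced words that end in the two sides of the commutation or braid relation between
  \<open>i\<close> and \<open>j\<close>; by induction these agree with the given words.\<close>
lemma reduced_words_eq:
  assumes "set us \<subseteq> {1..<m}" "word_perm us = w" "length us = ell w"
    and "set vs \<subseteq> {1..<m}" "word_perm vs = w" "length vs = ell w"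
  shows "idc_eq m (gens us) (gens vs)"
  using assms
proof (induction "ell w" arbitrary: w us vs rule: less_induct)
  case less
  have w: "w permutes {1..m}" using word_perm_permutes[OF less.prems(1)] less.prems(2) by simp
  show ?case
  proof (cases us rule: rev_cases)
    case Nil
    then show ?thesis using less.prems by simp
  next
    case us: (snoc us' i)
    then obtain vs' j where vs: "vs = vs' @ [j]"
      using less.prems by (cases vs rule: rev_cases) auto
    have ij: "i \<in> {1..<m}" "j \<in> {1..<m}" "set us' \<subseteq> {1..<m}" "set vs' \<subseteq> {1..<m}"
      using less.prems us vs by auto
    note u = reduced_snocD[OF less.prems(1-3)[unfolded us]]
    note v = reduced_snocD[OF less.prems(4-6)[unfolded vs]]
    note li = ell_descent[OF w ij(1) u(3)] and lj = ell_descent[OF w ij(2) v(3)]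
    \<comment> \<open>A reduced word \<open>q\<close> of \<open>w s\<^sub>i\<close> may replace the initial part of \<open>us\<close>, by induction; similarly for \<open>vs\<close>.\<close>
    have toward: "idc_eq m (gens us) (gens (q @ [i]))"
      if "set q \<subseteq> {1..<m}" "word_perm q = w \<circ> adj i" "length q = ell (w \<circ> adj i)" for q
      using less.hyps[OF _ ij(3) u(1,2) that] li us idc_eq_mult_right by auto
    have toward': "idc_eq m (gens vs) (gens (q @ [j]))"
      if "set q \<subseteq> {1..<m}" "word_perm q = w \<circ> adj j" "length q = ell (w \<circ> adj j)" for q
      using less.hyps[OF _ ij(4) v(1,2) that] lj vs idc_eq_mult_right by auto
    have perm: "w \<circ> adj i permutes {1..m}" "w \<circ> adj j permutes {1..m}"
      using comp_adj_permutes w ij by auto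
    have ne: "w (Suc i) \<noteq> w i" "w (Suc j) \<noteq> w j"
      using permutes_inj[OF w] by (simp_all add: inj_eq)
    have ?thesis if "i = j"
      using toward'[OF ij(3)] u that us idc_eq_sym by auto
    moreover have ?thesis if far: "i + 2 \<le> j \<or> j + 2 \<le> i"
    proof -
      let ?w = "w \<circ> adj i \<circ> adj j"
      have w': "?w = w \<circ> adj j \<circ> adj i" using far commute_perm by metis
      have "\<not> (w \<circ> adj i) j < (w \<circ> adj i) (Suc j)" using far v(3) by (auto simp: transpose_def)
      note l = ell_descent[OF perm(1) ij(2) this]
      obtain q where q: "set q \<subseteq> {1..<m}" "word_perm q = ?w" "length q = ell ?w"
        using ex_word[OF comp_adj_permutes[OF perm(1) ij(2)]] by blast
      have "idc_eq m (gens us) (gens ((q @ [j]) @ [i]))"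
      proof (rule toward)
        show "length (q @ [j]) = ell (w \<circ> adj i)" unfolding length_append_singleton q(3) using l by linarith
        show "word_perm (q @ [j]) = w \<circ> adj i" using q(2) by (simp add: word_perm_snoc adj_adj)
      qed (use q(1) ij in auto)
      moreover have "idc_eq m (gens vs) (gens ((q @ [i]) @ [j]))"
      proof (rule toward')
        show "length (q @ [i]) = ell (w \<circ> adj j)" unfolding length_append_singleton q(3) using l li lj by linarith
        show "word_perm (q @ [i]) = w \<circ> adj j" using q(2) unfolding w' by (simp add: word_perm_snoc adj_adj)
      qed (use q(1) ij in auto)
      moreover have "idc_eq m (gens ((q @ [j]) @ [i])) (gens ((q @ [i]) @ [j]))"
        using idc_eq_mult_left[OF idc_eq_commute[OF ij(2) ij(1)], of "gens q"] far
        by (auto simp: mult.assoc)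
      ultimately show ?thesis using idc_eq_trans idc_eq_sym by blast
    qed
    moreover have ?thesis if near: "j = Suc i \<or> i = Suc j"
    proof -
      let ?w = "w \<circ> adj i \<circ> adj j \<circ> adj i"
      have w': "?w = w \<circ> adj j \<circ> adj i \<circ> adj j" using near by (elim disjE) (simp_all only: braid_perm)
      have "\<not> (w \<circ> adj i) j < (w \<circ> adj i) (Suc j)"
        using near v(3) u(3) by (auto simp: transpose_def)
      note l = ell_descent[OF perm(1) ij(2) this]
      have "\<not> (w \<circ> adj i \<circ> adj j) i < (w \<circ> adj i \<circ> adj j) (Suc i)"
        using near v(3) u(3) by (auto simp: transpose_def)
      note l2 = ell_descent[OF comp_adj_permutes[OF perm(1) ij(2)] ij(1) this]
      obtain q where q: "set q \<subseteq> {1..<m}" "word_perm q = ?w" "length q = ell ?w"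
        using ex_word[OF comp_adj_permutes[OF comp_adj_permutes[OF perm(1) ij(2)] ij(1)]] by blast
      have "idc_eq m (gens us) (gens (((q @ [i]) @ [j]) @ [i]))"
      proof (rule toward)
        show "length ((q @ [i]) @ [j]) = ell (w \<circ> adj i)" unfolding length_append_singleton q(3) using l l2 by linarith
        show "word_perm ((q @ [i]) @ [j]) = w \<circ> adj i"
          by (simp only: word_perm_snoc q(2) adj_adj)
      qed (use q(1) ij in auto)
      moreover have "idc_eq m (gens vs) (gens (((q @ [j]) @ [i]) @ [j]))"
      proof (rule toward')
        show "word_perm ((q @ [j]) @ [i]) = w \<circ> adj j"
          by (simp only: word_perm_snoc q(2)[unfolded w'] adj_adj)
        show "length ((q @ [j]) @ [i]) = ell (w \<circ> adj j)" unfolding length_append_singleton q(3) using l l2 li lj by linarith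
      qed (use q ij in auto)
      moreover have "idc_eq m (gens (((q @ [i]) @ [j]) @ [i])) (gens (((q @ [j]) @ [i]) @ [j]))"
        using idc_eq_mult_left[OF idc_eq_braid[OF ij(1) ij(2)], of "gens q"] near
        by (auto simp: mult.assoc)
      ultimately show ?thesis using idc_eq_trans idc_eq_sym by blast
    qed
    ultimately show ?thesis by linarith
  qed
qed

lemma gen_perm_word:
  assumes "w permutes {1..m}"
  obtains us where "set us \<subseteq> {1..<m}" "word_perm us = w" "length us = ell w" "gen_perm m w = gens us"
proof -
  have "\<exists>us. is_reduced_word m w us" using ex_word[OF assms] is_reduced_word_iff[OF assms] by blast
  from someI_ex[OF this] show ?thesis
    using that is_reduced_word_iff[OF assms] by (auto simp: gen_perm_def)
qed

lemma gens_reduced: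
  assumes "set us \<subseteq> {1..<m}" "length us = ell (word_perm us)"
  shows "idc_eq m (gens us) (gen_perm m (word_perm us))"
proof -
  obtain vs where "set vs \<subseteq> {1..<m}" "word_perm vs = word_perm us" "length vs = ell (word_perm us)"
    "gen_perm m (word_perm us) = gens vs"
    by (rule gen_perm_word[OF word_perm_permutes[OF assms(1)]])
  then show ?thesis using reduced_words_eq[of us m _ vs] assms by simp
qed


section \<open>Demazure products\<close>

text \<open>The Demazure (\<open>0\<close>-Hecke) action of a letter: an ascent at \<open>t\<close> is turned into a descent, and
  a descent is kept.\<close>
definition dem :: "(nat \<Rightarrow> nat) \<Rightarrow> nat \<Rightarrow> (nat \<Rightarrow> nat)" where
  "dem v t = (if v t < v (Suc t) then v \<circ> adj t else v)"

text \<open>The Demazure product of a word.\<close>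
definition demazure :: "nat list \<Rightarrow> (nat \<Rightarrow> nat)" where
  "demazure us = foldl dem id us"

lemma dem_permutes: "v permutes {1..m} \<Longrightarrow> t \<in> {1..<m} \<Longrightarrow> dem v t permutes {1..m}"
  by (simp add: dem_def comp_adj_permutes del: One_nat_def)

lemma foldl_dem_permutes:
  "v permutes {1..m} \<Longrightarrow> set us \<subseteq> {1..<m} \<Longrightarrow> foldl dem v us permutes {1..m}"
  by (induction us arbitrary: v) (simp_all add: dem_permutes del: One_nat_def)

lemma demazure_permutes: "set us \<subseteq> {1..<m} \<Longrightarrow> demazure us permutes {1..m}"
  unfolding demazure_def by (rule foldl_dem_permutes[OF permutes_id])

lemma dem_idem: "dem (dem v t) t = dem v t"
  by (auto simp: dem_def)

lemma dem_commute: "i + 2 \<le> j \<Longrightarrow> dem (dem v i) j = dem (dem v j) i"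
  by (auto simp: dem_def fun_eq_iff transpose_def)

lemma dem_braid: "dem (dem (dem v i) (Suc i)) i = dem (dem (dem v (Suc i)) i) (Suc i)"
  by (auto simp: dem_def fun_eq_iff transpose_def)

lemma finite_ell_demazure:
  "finite (inversions (demazure us)) \<and> ell (demazure us) \<le> length us"
proof (induction us rule: rev_induct)
  case Nil
  show ?case unfolding demazure_def foldl_Nil inversions_id ell_id by simp
next
  case (snoc t us)
  show ?case
  proof (cases "demazure us t < demazure us (Suc t)")
    case True
    then have D: "demazure (us @ [t]) = demazure us \<circ> adj t" by (simp add: demazure_def dem_def)
    show ?thesis unfolding D
      using ell_ascent[OF True] snoc by (simp del: comp_apply)
  next
    case False
    then have "demazure (us @ [t]) = demazure us" by (simp add: demazure_def dem_def)
    then show ?thesis using snoc by simp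
  qed
qed

text \<open>The number of letters of a word that are absorbed when its Demazure product is formed. By
  \<open>finite_ell_demazure\<close> the subtraction does not truncate.\<close>
definition excess :: "nat list \<Rightarrow> nat" where
  "excess us = length us - ell (demazure us)"

text \<open>The \<open>e\<^sub>w\<close> span: a word \<open>u\<close> equals \<open>\<beta>\<^sup>r e\<^sub>w\<close> in \<open>IdC\<^sub>m(\<beta>)\<close>, where \<open>w\<close> is its Demazure
  product and \<open>r\<close> its excess.\<close>
lemma idc_eq_word:
  assumes "set us \<subseteq> {1..<m}"
  shows "idc_eq m (gens us) (scal (xconst beta ^ excess us) * gen_perm m (demazure us))"
  using assms
proof (induction us rule: rev_induct)
  case Nil
  have "idc_eq m (gens []) (gen_perm m (word_perm []))" by (rule gens_reduced) auto
  then show ?case unfolding demazure_def excess_def foldl_Nil word_perm_Nil ell_id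
    by (simp only: list.size diff_0_eq_0 power_0 scal_one mult_1_left)
next
  case (snoc t us)
  let ?w = "demazure us" and ?c = "scal (xconst beta ^ excess us)"
  have t: "t \<in> {1..<m}" "set us \<subseteq> {1..<m}" using snoc.prems by auto
  have w: "?w permutes {1..m}" using demazure_permutes t by blast
  note fin = finite_ell_demazure[of us]
  have "idc_eq m (gens us * gen t) (?c * gen_perm m ?w * gen t)"
    by (rule idc_eq_mult_right[OF snoc.IH]) (use t in auto)
  then have step: "idc_eq m (gens (us @ [t])) (?c * (gen_perm m ?w * gen t))"
    by (simp add: mult.assoc)
  show ?case
  proof (cases "?w t < ?w (Suc t)")
    case True
    have D: "demazure (us @ [t]) = ?w \<circ> adj t" using True by (simp add: demazure_def dem_def)
    have l: "ell (?w \<circ> adj t) = Suc (ell ?w)" using ell_ascent(2)[OF True] fin by simp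
    obtain q where q: "set q \<subseteq> {1..<m}" "word_perm q = ?w" "length q = ell ?w" "gen_perm m ?w = gens q"
      by (rule gen_perm_word[OF w])
    have P: "word_perm (q @ [t]) = ?w \<circ> adj t" by (simp only: word_perm_snoc q(2))
    have "idc_eq m (gens (q @ [t])) (gen_perm m (word_perm (q @ [t])))"
    proof (rule gens_reduced)
      show "length (q @ [t]) = ell (word_perm (q @ [t]))" unfolding P l using q(3) by simp
    qed (use q(1) t in auto)
    then have "idc_eq m (gen_perm m ?w * gen t) (gen_perm m (demazure (us @ [t])))"
      unfolding P D by (simp add: q(4))
    from idc_eq_trans[OF step idc_eq_mult_left[OF this]]
    show ?thesis unfolding excess_def D l by (simp del: comp_apply)
  next
    case False
    have D: "demazure (us @ [t]) = ?w" using False by (simp add: demazure_def dem_def)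
    have l: "ell ?w = Suc (ell (?w \<circ> adj t))" by (rule ell_descent[OF w t(1) False])
    obtain q where q: "set q \<subseteq> {1..<m}" "word_perm q = ?w \<circ> adj t" "length q = ell (?w \<circ> adj t)"
      using ex_word[OF comp_adj_permutes[OF w t(1)]] by blast
    have P: "word_perm (q @ [t]) = ?w" by (simp only: word_perm_snoc q(2) adj_adj)
    have "idc_eq m (gens (q @ [t])) (gen_perm m (word_perm (q @ [t])))"
    proof (rule gens_reduced)
      show "length (q @ [t]) = ell (word_perm (q @ [t]))" unfolding P l using q(3) by simp
    qed (use q(1) t in auto)
    then have red: "idc_eq m (gens q * gen t) (gen_perm m ?w)"
      unfolding P by simp
    have "idc_eq m (gen_perm m ?w * gen t) (gens q * gen t * gen t)"
      by (rule idc_eq_mult_right[OF idc_eq_sym[OF red]])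
    also have "idc_eq m \<dots> (gens q * (scal (xconst beta) * gen t))"
      using idc_eq_mult_left[OF idc_eq_square[OF t(1)], of "gens q"] by (simp add: mult.assoc)
    also have "gens q * (scal (xconst beta) * gen t) = scal (xconst beta) * (gens q * gen t)"
      by (rule mult_scal_left)
    also have "idc_eq m \<dots> (scal (xconst beta) * gen_perm m ?w)"
      by (rule idc_eq_mult_left[OF red])
    finally have "idc_eq m (gen_perm m ?w * gen t) (scal (xconst beta) * gen_perm m ?w)" .
    from idc_eq_trans[OF step idc_eq_mult_left[OF this, of ?c]]
    have "idc_eq m (gens (us @ [t])) (scal (xconst beta ^ excess us * xconst beta) * gen_perm m ?w)"
      by (simp add: scal_mult mult.assoc)
    moreover have "xconst beta ^ excess us * xconst beta = xconst beta ^ excess (us @ [t])"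
      using D fin by (simp add: excess_def Suc_diff_le mult.commute)
    ultimately show ?thesis using D by simp
  qed
qed

section \<open>The coefficient functionals\<close>

text \<open>The weight of a word in the coefficient of \<open>e\<^sub>w\<close>.\<close>
definition dem_weight :: "(nat \<Rightarrow> nat) \<Rightarrow> word \<Rightarrow> xpoly" where
  "dem_weight w u = (if demazure (letters u) = w then xconst beta ^ excess (letters u) else 0)"

text \<open>The coefficient of \<open>e\<^sub>w\<close>, defined on the free algebra. It vanishes on the ideal of relations
  (\<open>dem_coeff_ideal\<close>) and is dual to the \<open>e\<^sub>v\<close> (\<open>dem_coeff_gen_perm\<close>), so that the \<open>e\<^sub>v\<close> are
  linearly independent.\<close>
definition dem_coeff :: "(nat \<Rightarrow> nat) \<Rightarrow> free_alg \<Rightarrow> xpoly" where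
  "dem_coeff w = lin_ext (dem_weight w)"

text \<open>A relation \<open>p = c q\<close> between two words need only be tested inside longer words.\<close>
lemma sandwich_eq:
  assumes "\<And>u v. dem_weight w (u + p + v) = c * dem_weight w (u + q + v)"
  shows "dem_coeff w (a * (Poly_Mapping.single p 1 - Poly_Mapping.single q c) * b) = 0"
  by (simp only: dem_coeff_def right_diff_distrib left_diff_distrib lin_ext_diff lin_ext_sandwich assms)
     simp

lemma dem_coeff_relator:
  assumes "s \<in> idc_relators m"
  shows "dem_coeff w (a * s * b) = 0"
proof -
  consider (comm) i j where "s = gen i * gen j - gen j * gen i" "i + 2 \<le> j \<or> j + 2 \<le> i"
    | (braid) i j where "s = gen i * gen j * gen i - gen j * gen i * gen j" "j = Suc i \<or> i = Suc j"
    | (square) i where "s = gen i * gen i - scal (xconst beta) * gen i"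
    using assms by (auto simp: idc_relators_def)
  then show ?thesis
  proof cases
    case comm
    have s: "s = Poly_Mapping.single (Word [i, j]) 1 - Poly_Mapping.single (Word [j, i]) 1"
      by (simp add: comm(1) gen_def mult_single plus_word_def)
    have "demazure (us @ [i, j] @ vs) = demazure (us @ [j, i] @ vs)" for us vs
      using comm(2) dem_commute[of i j] dem_commute[of j i] by (elim disjE) (simp_all add: demazure_def)
    then show ?thesis unfolding s
      by (intro sandwich_eq) (simp add: dem_weight_def plus_word_def excess_def)
  next
    case braid
    have s: "s = Poly_Mapping.single (Word [i, j, i]) 1 - Poly_Mapping.single (Word [j, i, j]) 1"
      by (simp add: braid(1) gen_def mult_single plus_word_def)
    have "demazure (us @ [i, j, i] @ vs) = demazure (us @ [j, i, j] @ vs)" for us vs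
      using braid(2) by (auto simp: demazure_def dem_braid)
    then show ?thesis unfolding s
      by (intro sandwich_eq) (simp add: dem_weight_def plus_word_def excess_def)
  next
    case square
    have s: "s = Poly_Mapping.single (Word [i, i]) 1 - Poly_Mapping.single (Word [i]) (xconst beta)"
      by (simp add: square gen_def scal_def mult_single plus_word_def zero_word_def)
    have D: "demazure (us @ [i, i] @ vs) = demazure (us @ [i] @ vs)" for us vs
      by (simp add: demazure_def dem_idem)
    have "excess (us @ [i, i] @ vs) = Suc (excess (us @ [i] @ vs))" for us vs
      using finite_ell_demazure[of "us @ [i] @ vs"] unfolding excess_def D by (simp add: Suc_diff_le)
    with D show ?thesis unfolding s
      by (intro sandwich_eq) (simp add: dem_weight_def plus_word_def)
  qed
qed

lemma dem_coeff_ideal: "x \<in> two_sided_ideal (idc_relators m) \<Longrightarrow> dem_coeff w x = 0"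
proof (induction rule: two_sided_ideal.induct)
  case zero
  show ?case by (simp add: dem_coeff_def)
next
  case (gen s a b)
  then show ?case by (rule dem_coeff_relator)
next
  case (add x y)
  then show ?case by (simp add: dem_coeff_def lin_ext_add)
qed

lemma dem_coeff_cong: "idc_eq m a b \<Longrightarrow> dem_coeff w a = dem_coeff w b"
  using dem_coeff_ideal[of "a - b" m w] by (simp add: idc_eq_def dem_coeff_def lin_ext_diff)

lemma demazure_reduced:
  assumes "set us \<subseteq> {1..<m}" "length us = ell (word_perm us)"
  shows "demazure us = word_perm us"
  using assms
proof (induction us rule: rev_induct)
  case Nil
  show ?case by (simp only: demazure_def foldl_Nil word_perm_Nil)
next
  case (snoc t us)
  note r = reduced_snocD[OF snoc.prems(1) refl snoc.prems(2)]
  have us: "set us \<subseteq> {1..<m}" "t \<in> {1..<m}" using snoc.prems(1) by auto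
  have d: "demazure us = word_perm us" by (rule snoc.IH[OF us(1)]) (use r(2) in \<open>unfold r(1)[symmetric]\<close>)
  have "word_perm us (Suc t) \<noteq> word_perm us t"
    using permutes_inj[OF word_perm_permutes[OF us(1)]] by (simp add: inj_eq)
  then have "word_perm us t < word_perm us (Suc t)" using r(3) unfolding word_perm_snoc by simp
  then show ?case unfolding word_perm_snoc using d by (simp add: demazure_def dem_def)
qed

lemma dem_coeff_gen_perm:
  assumes "v permutes {1..m}"
  shows "dem_coeff w (scal c * gen_perm m v) = (if v = w then c else 0)"
proof -
  obtain q where q: "set q \<subseteq> {1..<m}" "word_perm q = v" "length q = ell v" "gen_perm m v = gens q"
    by (rule gen_perm_word[OF assms])
  then have "demazure q = v" "excess q = 0" using demazure_reduced[of q m] by (auto simp: excess_def)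
  then show ?thesis
    unfolding q(4) by (simp add: prod_gen scal_def mult_single dem_coeff_def dem_weight_def)
qed

lemma finite_perms: "finite {w. w permutes {1..m::nat}}"
  by (rule finite_permutations) simp

text \<open>The coefficients of a combination of the \<open>e\<^sub>w\<close> are determined by its class in
  \<open>IdC\<^sub>m(\<beta>)\<close>.\<close>
lemma dem_coeff_family:
  assumes "idc_eq m a (\<Sum>v | v permutes {1..m}. scal (G v) * gen_perm m v)" "w permutes {1..m}"
  shows "G w = dem_coeff w a"
proof -
  have "dem_coeff w a = (\<Sum>v | v permutes {1..m}. dem_coeff w (scal (G v) * gen_perm m v))"
    unfolding dem_coeff_cong[OF assms(1)] by (simp add: dem_coeff_def lin_ext_sum)
  also have "\<dots> = (\<Sum>v | v permutes {1..m}. if v = w then G v else 0)"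
    by (intro sum.cong) (simp_all add: dem_coeff_gen_perm)
  also have "\<dots> = G w" using assms(2) finite_perms[of m] by (simp add: sum.delta)
  finally show ?thesis ..
qed

section \<open>Expanding products of linear factors\<close>

lemma prod_list_linear_factors:
  fixes L :: "'c \<Rightarrow> nat" and X :: "'c \<Rightarrow> xpoly"
  assumes "distinct cs"
  shows "prod_list (map (\<lambda>c. h_fac (L c) (X c)) cs) =
    (\<Sum>S\<in>Pow (set cs). Poly_Mapping.single (Word (map L (filter (\<lambda>c. c \<in> S) cs))) (\<Prod>c\<in>S. X c))"
  using assms
proof (induction cs rule: rev_induct)
  case Nil
  show ?case by (simp flip: zero_word_def)
next
  case (snoc c cs)
  let ?P = "\<lambda>cs S. Poly_Mapping.single (Word (map L (filter (\<lambda>c. c \<in> S) cs))) (\<Prod>c\<in>S. X c)"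
  have c: "c \<notin> set cs" "distinct cs" using snoc.prems by auto
  have h: "h_fac (L c) (X c) = 1 + Poly_Mapping.single (Word [L c]) (X c)"
    by (simp add: h_fac_def scal_def gen_def mult_single plus_word_def zero_word_def)
  have 1: "?P (cs @ [c]) S = ?P cs S" if "S \<in> Pow (set cs)" for S
    using that c by auto
  have 2: "?P (cs @ [c]) (insert c S) = ?P cs S * Poly_Mapping.single (Word [L c]) (X c)"
    if "S \<in> Pow (set cs)" for S
  proof -
    have "c \<notin> S" "finite S" using that c finite_subset by auto
    moreover have "filter (\<lambda>x. x \<in> insert c S) cs = filter (\<lambda>x. x \<in> S) cs"
      using c by (intro filter_cong) auto
    ultimately show ?thesis by (simp add: mult_single plus_word_def mult.commute)
  qed
  have "(\<Sum>S\<in>Pow (set (cs @ [c])). ?P (cs @ [c]) S)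
      = (\<Sum>S\<in>Pow (set cs). ?P (cs @ [c]) S) + (\<Sum>S\<in>insert c ` Pow (set cs). ?P (cs @ [c]) S)"
    using c by (simp only: set_append list.set Un_insert_right Un_empty_right Pow_insert)
       (intro sum.union_disjoint, auto)
  also have "(\<Sum>S\<in>insert c ` Pow (set cs). ?P (cs @ [c]) S)
      = (\<Sum>S\<in>Pow (set cs). ?P (cs @ [c]) (insert c S))"
    using c by (intro sum.reindex_cong[where l = "insert c"]) (auto simp: inj_on_def)
  also have "(\<Sum>S\<in>Pow (set cs). ?P (cs @ [c]) S) + \<dots> = (\<Sum>S\<in>Pow (set cs). ?P cs S)
      + (\<Sum>S\<in>Pow (set cs). ?P cs S * Poly_Mapping.single (Word [L c]) (X c))"
    by (intro arg_cong2[where f = "(+)"] sum.cong refl 1 2)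
  also have "\<dots> = prod_list (map (\<lambda>c. h_fac (L c) (X c)) (cs @ [c]))"
    using snoc.IH c by (simp add: h distrib_left sum_distrib_right)
  finally show ?case ..
qed

text \<open>The factors of \<open>A\<^sub>1(x\<^sub>1) \<cdots> A\<^sub>m\<^sub>-\<^sub>1(x\<^sub>m\<^sub>-\<^sub>1)\<close> in the order of the product: the cell \<open>(i, t)\<close>
  stands for the factor \<open>h\<^sub>t(x\<^sub>i)\<close>, and in each row \<open>i\<close> the letters \<open>t\<close> decrease.\<close>
definition cells :: "nat \<Rightarrow> (nat \<times> nat) list" where
  "cells m = concat (map (\<lambda>i. map (Pair i) (rev [i..<m])) [1..<m])"

lemma set_cells: "set (cells m) = {(i, t). 1 \<le> i \<and> i \<le> t \<and> t < m}"
  by (auto simp: cells_def image_iff)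

lemma distinct_cells: "distinct (cells m)"
proof -
  have "inj_on (\<lambda>i. map (Pair i) (rev [i..<m])) (set [1..<m])"
  proof (rule inj_onI)
    fix i j assume i: "i \<in> set [1..<m]" and eq: "map (Pair i) (rev [i..<m]) = map (Pair j) (rev [j..<m])"
    from i have "(i, i) \<in> set (map (Pair i) (rev [i..<m]))" by auto
    then have "(i, i) \<in> set (map (Pair j) (rev [j..<m]))" unfolding eq .
    then show "i = j" by auto
  qed
  then show ?thesis
    unfolding cells_def by (intro distinct_concat) (auto simp: distinct_map inj_on_def)
qed

text \<open>The letters of the cells in \<open>S\<close>, in the order of the product.\<close>
definition subword :: "nat \<Rightarrow> (nat \<times> nat) set \<Rightarrow> nat list" where
  "subword m S = map snd (filter (\<lambda>c. c \<in> S) (cells m))"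

lemma A_product:
  "prod_list (map (\<lambda>i. A_fac m i (xvar i)) [1..<m]) =
    (\<Sum>S\<in>Pow (set (cells m)). Poly_Mapping.single (Word (subword m S)) (\<Prod>c\<in>S. xvar (fst c)))"
proof -
  have concat: "prod_list (concat xss) = prod_list (map prod_list xss)" for xss :: "free_alg list list"
    by (induction xss) simp_all
  have "prod_list (map (\<lambda>i. A_fac m i (xvar i)) [1..<m])
      = prod_list (map (\<lambda>c. h_fac (snd c) (xvar (fst c))) (cells m))"
    by (simp add: cells_def map_concat concat A_fac_def comp_def)
  then show ?thesis
    unfolding subword_def by (simp only: prod_list_linear_factors[OF distinct_cells])
qed

lemma subword_letters: "S \<subseteq> set (cells m) \<Longrightarrow> set (subword m S) \<subseteq> {1..<m}"
  by (auto simp: subword_def set_cells)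

lemma length_subword:
  assumes "S \<subseteq> set (cells m)"
  shows "length (subword m S) = card S"
proof -
  have "length (subword m S) = card (set (filter (\<lambda>c. c \<in> S) (cells m)))"
    unfolding subword_def length_map by (rule distinct_card[symmetric]) (simp add: distinct_cells)
  also have "set (filter (\<lambda>c. c \<in> S) (cells m)) = S" using assms by auto
  finally show ?thesis .
qed

section \<open>Grothendieck polynomials as sums over subwords\<close>

lemma grothendieck_family:
  "is_groth_family m (\<lambda>w. dem_coeff w (prod_list (map (\<lambda>i. A_fac m i (xvar i)) [1..<m])))"
proof -
  let ?D = "\<lambda>S. demazure (subword m S)" and ?x = "\<lambda>S. \<Prod>c\<in>S. xvar (fst c)"
  let ?b = "\<lambda>S. xconst beta ^ excess (subword m S)"
  let ?I = "Pow (set (cells m))" and ?Perm = "{w. w permutes {1..m}}"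
  have coeff: "dem_coeff w (prod_list (map (\<lambda>i. A_fac m i (xvar i)) [1..<m]))
      = (\<Sum>S\<in>?I. if ?D S = w then ?x S * ?b S else 0)" for w
    unfolding A_product by (auto simp: dem_coeff_def lin_ext_sum dem_weight_def intro!: sum.cong)
  have "idc_eq m (prod_list (map (\<lambda>i. A_fac m i (xvar i)) [1..<m]))
      (\<Sum>S\<in>?I. scal (?x S * ?b S) * gen_perm m (?D S))"
    unfolding A_product
  proof (rule idc_eq_sum)
    fix S assume "S \<in> ?I"
    then have "set (subword m S) \<subseteq> {1..<m}" using subword_letters by blast
    from idc_eq_mult_left[OF idc_eq_word[OF this], of "scal (?x S)"]
    show "idc_eq m (Poly_Mapping.single (Word (subword m S)) (?x S))
        (scal (?x S * ?b S) * gen_perm m (?D S))"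
      by (simp add: prod_gen scal_mult mult.assoc)
        (simp add: scal_def mult_single)
  qed
  also have "(\<Sum>S\<in>?I. scal (?x S * ?b S) * gen_perm m (?D S))
      = (\<Sum>S\<in>?I. \<Sum>w\<in>?Perm. scal (if ?D S = w then ?x S * ?b S else 0) * gen_perm m w)"
  proof (rule sum.cong[OF refl])
    fix S assume "S \<in> ?I"
    then have "?D S \<in> ?Perm" using demazure_permutes subword_letters by blast
    moreover have "scal (if ?D S = w then ?x S * ?b S else 0) * gen_perm m w
        = (if ?D S = w then scal (?x S * ?b S) * gen_perm m w else 0)" for w
      by (simp add: scal_def)
    ultimately show "scal (?x S * ?b S) * gen_perm m (?D S)
        = (\<Sum>w\<in>?Perm. scal (if ?D S = w then ?x S * ?b S else 0) * gen_perm m w)"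
      using finite_perms[of m] by (simp add: sum.delta)
  qed
  also have "\<dots> = (\<Sum>w\<in>?Perm. scal (\<Sum>S\<in>?I. if ?D S = w then ?x S * ?b S else 0) * gen_perm m w)"
    unfolding scal_sum sum_distrib_right by (rule sum.swap)
  finally show ?thesis
    unfolding is_groth_family_def coeff .
qed

lemma grothendieck_eq:
  assumes "w permutes {1..m}"
  shows "grothendieck m w = dem_coeff w (prod_list (map (\<lambda>i. A_fac m i (xvar i)) [1..<m]))"
  unfolding grothendieck_def
proof (rule the_equality)
  show "\<exists>G. is_groth_family m G \<and> G w = dem_coeff w (prod_list (map (\<lambda>i. A_fac m i (xvar i)) [1..<m]))"
    using grothendieck_family by blast
next
  fix p assume "\<exists>G. is_groth_family m G \<and> G w = p"
  then show "p = dem_coeff w (prod_list (map (\<lambda>i. A_fac m i (xvar i)) [1..<m]))"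
    using dem_coeff_family[OF _ assms] by (auto simp: is_groth_family_def)
qed

text \<open>Evaluation at \<open>x\<^sub>i = 1\<close> is the sum of the coefficients, which is multiplicative.\<close>
lemma xeval_one_mult: "xeval (\<lambda>_. 1) (p * q) = xeval (\<lambda>_. 1) p * xeval (\<lambda>_. 1) q"
  unfolding xeval_one by (rule lin_ext_mult_hom) simp

lemma xeval_one_zero [simp]: "xeval (\<lambda>_. 1) 0 = 0"
  by (simp add: xeval_one)

lemma xeval_one_const [simp]: "xeval (\<lambda>_. 1) (xconst c) = c"
  by (simp add: xeval_one xconst_def)

lemma xeval_one_var [simp]: "xeval (\<lambda>_. 1) (xvar i) = 1"
  by (simp add: xeval_one xvar_def)

lemma xeval_one_one [simp]: "xeval (\<lambda>_. 1) 1 = 1"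
  using xeval_one_const[of 1] by (simp add: xconst_def)

lemma xeval_one_power: "xeval (\<lambda>_. 1) (p ^ e) = xeval (\<lambda>_. 1) p ^ e"
  by (induction e) (simp_all add: xeval_one_mult)

lemma xeval_one_vars: "xeval (\<lambda>_. 1) (\<Prod>c\<in>S. xvar (f c)) = 1"
  by (induction S rule: infinite_finite_induct) (simp_all add: xeval_one_mult)

text \<open>The formula of Fomin and Kirillov at \<open>x\<^sub>i = 1\<close>: the Grothendieck polynomial counts the
  subwords with Demazure product \<open>w\<close>.\<close>
lemma xeval_grothendieck:
  assumes "w permutes {1..m}"
  shows "xeval (\<lambda>_. 1) (grothendieck m w) =
    (\<Sum>S | S \<subseteq> set (cells m) \<and> demazure (subword m S) = w. beta ^ (card S - ell w))"
proof -
  let ?I = "Pow (set (cells m))"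
  have "xeval (\<lambda>_. 1) (grothendieck m w) = (\<Sum>S\<in>?I. xeval (\<lambda>_. 1)
      ((\<Prod>c\<in>S. xvar (fst c)) * dem_weight w (Word (subword m S))))"
    unfolding grothendieck_eq[OF assms] A_product
    by (simp add: dem_coeff_def lin_ext_sum xeval_one)
  also have "\<dots> = (\<Sum>S\<in>?I. if demazure (subword m S) = w then beta ^ (card S - ell w) else 0)"
  proof (rule sum.cong[OF refl])
    fix S assume "S \<in> ?I"
    then have "length (subword m S) = card S" using length_subword by blast
    then show "xeval (\<lambda>_. 1) ((\<Prod>c\<in>S. xvar (fst c)) * dem_weight w (Word (subword m S)))
        = (if demazure (subword m S) = w then beta ^ (card S - ell w) else 0)"
      by (auto simp: dem_weight_def xeval_one_mult xeval_one_power xeval_one_vars excess_def)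
  qed
  also have "\<dots> = (\<Sum>S | S \<subseteq> set (cells m) \<and> demazure (subword m S) = w. beta ^ (card S - ell w))"
    by (rule sum.mono_neutral_cong_right) auto
  finally show ?thesis .
qed


section \<open>Rank functions\<close>

text \<open>The number of positions in \<open>{1..x}\<close> with a value greater than \<open>y\<close>.\<close>
definition rk :: "(nat \<Rightarrow> nat) \<Rightarrow> nat \<Rightarrow> nat \<Rightarrow> nat" where
  "rk v y x = (\<Sum>a=1..x. of_bool (y < v a))"

lemma rk_0 [simp]: "rk v y 0 = 0"
  by (simp add: rk_def)

lemma rk_Suc: "rk v y (Suc x) = rk v y x + of_bool (y < v (Suc x))"
  by (simp add: rk_def)

lemma rk_cong: "(\<And>a. a \<le> x \<Longrightarrow> v a = w a) \<Longrightarrow> rk v y x = rk w y x"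
  unfolding rk_def by (rule sum.cong) auto

lemma rk_id: "rk id y x = x - y"
  by (induction x) (auto simp: rk_Suc)

lemma rk_dem_other:
  assumes "1 \<le> t" "x \<noteq> t"
  shows "rk (dem v t) y x = rk v y x"
proof (cases "v t < v (Suc t)")
  case True
  have "rk (v \<circ> adj t) y x = rk v y x"
  proof (cases "x < t")
    case True
    then show ?thesis by (intro rk_cong) (auto simp: transpose_def)
  next
    case False
    then have "adj t permutes {1..x}" using assms by (intro permutes_swap_id) auto
    from sum.permute[OF this, of "\<lambda>a. of_bool (y < v a) :: nat"] show ?thesis
      by (simp add: rk_def comp_def)
  qed
  with True show ?thesis unfolding dem_def by simp
qed (simp add: dem_def)

text \<open>In terms of ranks, the Demazure action is a \<open>(min, +)\<close> recursion.\<close>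
lemma rk_dem:
  assumes "1 \<le> t"
  shows "rk (dem v t) y t = min (rk v y (t - 1) + 1) (rk v y (Suc t))"
proof -
  obtain s where t: "t = Suc s" using assms by (cases t) auto
  have "dem v t t = max (v t) (v (Suc t))" by (auto simp: dem_def)
  moreover have "rk (dem v t) y s = rk v y s" by (rule rk_dem_other) (use t in auto)
  ultimately show ?thesis unfolding t rk_Suc by auto
qed

lemma rk_dem_mono:
  assumes "1 \<le> t"
  shows "rk v y x \<le> rk (dem v t) y x"
proof (cases "x = t")
  case True
  obtain s where "t = Suc s" using assms by (cases t) auto
  then show ?thesis using True rk_dem[OF assms, of v y] by (simp add: rk_Suc)
qed (simp add: rk_dem_other assms[simplified])

lemma rk_foldl_mono: "0 \<notin> set us \<Longrightarrow> rk v y x \<le> rk (foldl dem v us) y x"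
proof (induction us arbitrary: v)
  case (Cons t us)
  have "rk v y x \<le> rk (dem v t) y x" using Cons.prems by (intro rk_dem_mono) auto
  also have "\<dots> \<le> rk (foldl dem (dem v t) us) y x" using Cons by auto
  finally show ?case by simp
qed simp

text \<open>A row of decreasing letters acts in one sweep: when letter \<open>x\<close> is processed, the rank at
  \<open>x + 1\<close> is the new one, whereas the ranks at \<open>x\<close> and \<open>x - 1\<close> are still the old ones.\<close>
lemma rk_row:
  fixes P :: "nat \<Rightarrow> bool" and v :: "nat \<Rightarrow> nat" and b :: nat
  assumes "1 \<le> a"
  defines "W \<equiv> \<lambda>a. foldl dem v (filter P (rev [a..<b]))"
  shows "rk (W a) y x = (if a \<le> x \<and> x < b \<and> P x
    then min (rk v y (x - 1) + 1) (rk (W a) y (Suc x)) else rk v y x)"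
proof (cases "a \<le> b")
  case True
  then show ?thesis using assms(1)
  proof (induction a arbitrary: x rule: inc_induct)
    case base
    then show ?case by (simp add: W_def)
  next
    case (step a)
    have W: "W a = (if P a then dem (W (Suc a)) a else W (Suc a))"
      using step.hyps by (simp add: W_def upt_conv_Cons)
    have above: "rk (W a) y z = rk (W (Suc a)) y z" if "z \<noteq> a" for z
      unfolding W using that step.prems by (simp add: rk_dem_other)
    have IH: "rk (W (Suc a)) y z = (if Suc a \<le> z \<and> z < b \<and> P z
        then min (rk v y (z - 1) + 1) (rk (W (Suc a)) y (Suc z)) else rk v y z)" for z
      using step.IH[of z] step.prems by simp
    show ?case
    proof (cases "x = a")
      case x: True
      show ?thesis
      proof (cases "P a")
        case P: True
        have "rk (W a) y a = min (rk (W (Suc a)) y (a - 1) + 1) (rk (W (Suc a)) y (Suc a))"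
          using W P rk_dem[of a "W (Suc a)" y] step.prems by simp
        also have "rk (W (Suc a)) y (a - 1) = rk v y (a - 1)" by (subst IH) auto
        also have "rk (W (Suc a)) y (Suc a) = rk (W a) y (Suc a)" using above by simp
        finally show ?thesis using x P step.hyps by simp
      next
        case False
        then have "rk (W a) y a = rk (W (Suc a)) y a" using W by simp
        also have "\<dots> = rk v y a" by (subst IH) auto
        finally show ?thesis using x False by simp
      qed
    next
      case False
      show ?thesis
      proof (cases "a \<le> x \<and> x < b \<and> P x")
        case True
        then show ?thesis using above[OF False] above[of "Suc x"] IH[of x] False by auto
      next
        case F: False
        then show ?thesis using above[OF False] IH[of x] by auto
      qed
    qed
  qed
qed (simp add: W_def)

section \<open>Longest chains in a grid\<close>

text \<open>The length of the longest chain in the \<open>r \<times> c\<close> grid whose elements satisfy \<open>P\<close>, by the recursion for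
  longest common subsequences. Chains increase strictly in both coordinates.\<close>
fun lcs :: "(nat \<Rightarrow> nat \<Rightarrow> bool) \<Rightarrow> nat \<Rightarrow> nat \<Rightarrow> nat" where
  "lcs P 0 c = 0"
| "lcs P (Suc r) 0 = 0"
| "lcs P (Suc r) (Suc c) =
    (if P r c then Suc (lcs P r c) else max (lcs P r (Suc c)) (lcs P (Suc r) c))"

lemma lcs_0_right [simp]: "lcs P r 0 = 0"
  by (cases r) auto

lemma lcs_le: "lcs P r c \<le> r"
  by (induction P r c rule: lcs.induct) auto

text \<open>Any two distinct elements are comparable, strictly in both coordinates.\<close>
definition is_chain :: "(nat \<times> nat) set \<Rightarrow> bool" where
  "is_chain C \<longleftrightarrow> (\<forall>p\<in>C. \<forall>q\<in>C. p = q \<or> (fst p < fst q \<and> snd p < snd q) \<or> (fst q < fst p \<and> snd q < snd p))"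

text \<open>The admissible elements of the \<open>r \<times> c\<close> grid.\<close>
definition box :: "(nat \<Rightarrow> nat \<Rightarrow> bool) \<Rightarrow> nat \<Rightarrow> nat \<Rightarrow> (nat \<times> nat) set" where
  "box P r c = {(r', c'). r' < r \<and> c' < c \<and> P r' c'}"

lemma finite_box: "finite (box P r c)"
  by (rule finite_subset[of _ "{..<r} \<times> {..<c}"]) (auto simp: box_def)

lemma is_chain_subset: "is_chain C \<Longrightarrow> D \<subseteq> C \<Longrightarrow> is_chain D"
  unfolding is_chain_def by blast

lemma card_chain_le: "is_chain C \<Longrightarrow> C \<subseteq> box P r c \<Longrightarrow> card C \<le> lcs P r c"
proof (induction P r c arbitrary: C rule: lcs.induct)
  case (1 P c)
  then have "C = {}" by (auto simp: box_def)
  then show ?case by simp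
next
  case (2 P r)
  then have "C = {}" by (auto simp: box_def)
  then show ?case by simp
next
  case (3 P r c)
  have fin: "finite C" using "3.prems"(2) finite_box finite_subset by blast
  have cmp: "p = q \<or> (fst p < fst q \<and> snd p < snd q) \<or> (fst q < fst p \<and> snd q < snd p)"
    if "p \<in> C" "q \<in> C" for p q using "3.prems"(1) that by (auto simp: is_chain_def)
  have sub: "fst p < Suc r \<and> snd p < Suc c \<and> P (fst p) (snd p)" if "p \<in> C" for p
    using "3.prems"(2) that by (auto simp: box_def)
  show ?case
  proof (cases "P r c")
    case True
    have "\<exists>z. C - {z} \<subseteq> box P r c"
    proof (cases "\<exists>z\<in>C. fst z = r \<or> snd z = c")
      case True
      then obtain z where z: "z \<in> C" "fst z = r \<or> snd z = c" by blast
      have "p \<in> box P r c" if "p \<in> C - {z}" for p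
        using sub[of p] sub[OF z(1)] cmp[of p z] z that by (auto simp: box_def)
      then show ?thesis by blast
    next
      case False
      then have "C \<subseteq> box P r c" using sub by (force simp: box_def less_Suc_eq)
      then show ?thesis by blast
    qed
    then obtain z where "C - {z} \<subseteq> box P r c" by blast
    then have "card (C - {z}) \<le> lcs P r c"
      using "3.IH"(1)[OF True] is_chain_subset[OF "3.prems"(1)] by blast
    moreover have "card C \<le> Suc (card (C - {z}))" by (simp add: card_Diff_singleton_if) arith
    ultimately show ?thesis using True by simp
  next
    case False
    have "C \<subseteq> box P r (Suc c) \<or> C \<subseteq> box P (Suc r) c"
    proof (rule ccontr)
      assume "\<not> ?thesis"
      then obtain p q where p: "p \<in> C" "p \<notin> box P r (Suc c)" and q: "q \<in> C" "q \<notin> box P (Suc r) c"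
        by blast
      have "fst p = r" "snd q = c" using p q sub[of p] sub[of q] by (auto simp: box_def)
      moreover have "p \<noteq> q" using calculation False sub[of p] p by auto
      ultimately show False using cmp[of p q] sub[of p] sub[of q] p q by auto
    qed
    then show ?thesis
    proof
      assume "C \<subseteq> box P r (Suc c)"
      from "3.IH"(2)[OF False "3.prems"(1) this] False show ?thesis by simp
    next
      assume "C \<subseteq> box P (Suc r) c"
      from "3.IH"(3)[OF False "3.prems"(1) this] False show ?thesis by simp
    qed
  qed
qed

lemma ex_chain: "\<exists>C. is_chain C \<and> C \<subseteq> box P r c \<and> card C = lcs P r c"
proof (induction P r c rule: lcs.induct)
  case (1 P c)
  show ?case by (rule exI[of _ "{}"]) (simp add: is_chain_def)
next
  case (2 P r)
  show ?case by (rule exI[of _ "{}"]) (simp add: is_chain_def)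
next
  case (3 P r c)
  show ?case
  proof (cases "P r c")
    case True
    obtain C where C: "is_chain C" "C \<subseteq> box P r c" "card C = lcs P r c"
      using "3.IH"(1)[OF True] by blast
    have fin: "finite C" using C(2) finite_box finite_subset by blast
    have lt: "fst p < r \<and> snd p < c" if "p \<in> C" for p using C(2) that by (auto simp: box_def)
    then have "(r, c) \<notin> C" by force
    moreover have "is_chain (insert (r, c) C)"
      using C(1) lt by (auto simp: is_chain_def)
    moreover have "insert (r, c) C \<subseteq> box P (Suc r) (Suc c)"
      using C(2) True by (auto simp: box_def)
    ultimately show ?thesis using C(3) fin True by (intro exI[of _ "insert (r, c) C"]) simp
  next
    case False
    have *: "box P r (Suc c) \<subseteq> box P (Suc r) (Suc c)" "box P (Suc r) c \<subseteq> box P (Suc r) (Suc c)"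
      by (auto simp: box_def)
    show ?thesis
    proof (cases "lcs P (Suc r) c \<le> lcs P r (Suc c)")
      case True
      then show ?thesis using "3.IH"(2)[OF False] * False by (auto simp: max_def)
    next
      case F: False
      then show ?thesis using "3.IH"(3)[OF False] * False by (auto simp: max_def)
    qed
  qed
qed

lemma ex_chain_card_iff: "(\<exists>C. is_chain C \<and> C \<subseteq> box P r c \<and> card C = j) \<longleftrightarrow> j \<le> lcs P r c"
proof
  assume "\<exists>C. is_chain C \<and> C \<subseteq> box P r c \<and> card C = j"
  then show "j \<le> lcs P r c" using card_chain_le by blast
next
  assume "j \<le> lcs P r c"
  then obtain C where "is_chain C" "C \<subseteq> box P r c" "j \<le> card C" using ex_chain[of P r c] by auto
  moreover then obtain D where "D \<subseteq> C" "card D = j" using obtain_subset_with_card_n by metis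
  ultimately show "\<exists>C. is_chain C \<and> C \<subseteq> box P r c \<and> card C = j"
    using is_chain_subset by blast
qed

section \<open>Ranks of Demazure products of subwords\<close>

text \<open>The Demazure product of the first \<open>r\<close> rows of a subword.\<close>
primrec row_state :: "nat \<Rightarrow> (nat \<times> nat) set \<Rightarrow> nat \<Rightarrow> (nat \<Rightarrow> nat)" where
  "row_state m S 0 = id"
| "row_state m S (Suc r) =
     foldl dem (row_state m S r) (filter (\<lambda>t. (Suc r, t) \<in> S) (rev [Suc r..<m]))"

text \<open>The cells that a subword omits, in the coordinates of the grid on which chains are measured
  for the threshold \<open>y\<close>: the row \<open>r + 1\<close> and the letter \<open>y + r - c\<close>. Column \<open>c\<close> collects the cells
  whose diagonals have the same larger end point. Grid points that are not cells, with letters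
  \<open>t \<ge> m\<close>, count as omitted; so do the cells with \<open>t \<le> k\<close> for the subwords of interest. The chords of
  both are sides or diagonals of length at most \<open>k\<close>, which lie in no family of \<open>k + 1\<close> pairwise
  crossing diagonals.\<close>
abbreviation missing :: "(nat \<times> nat) set \<Rightarrow> nat \<Rightarrow> nat \<Rightarrow> nat \<Rightarrow> bool" where
  "missing S y \<equiv> \<lambda>r c. (Suc r, y + r - c) \<notin> S"

lemma row_state_eq: "demazure (subword m S) = row_state m S (m - 1)"
proof -
  have filt: "map snd (filter (\<lambda>c. c \<in> S) (map (Pair i) ts)) = filter (\<lambda>t. (i, t) \<in> S) ts" for i ts
    by (induction ts) auto
  have "foldl dem id (map snd (filter (\<lambda>c. c \<in> S) (concat (map (\<lambda>i. map (Pair i) (rev [i..<m])) [1..<Suc r]))))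
      = row_state m S r" for r
  proof (induction r)
    case (Suc r)
    have "[1..<Suc (Suc r)] = [1..<Suc r] @ [Suc r]" by simp
    then show ?case using Suc
      by (simp only: map_append concat_append filter_append foldl_append filt
          list.map concat.simps append_Nil2 row_state.simps)
  qed simp
  from this[of "m - 1"] show ?thesis
    by (cases m) (simp_all add: demazure_def subword_def cells_def)
qed

text \<open>The heart of the argument: up to the affine change \<open>j \<mapsto> r - j\<close>, the recursion for the ranks
  after \<open>r\<close> rows is the recursion for the longest chains of missing cells.\<close>
lemma rk_row_state:
  fixes S :: "(nat \<times> nat) set" and y :: nat
  assumes S: "S \<subseteq> set (cells m)"
  defines "P \<equiv> missing S y"
  shows "(\<forall>x\<ge>y + r. rk (row_state m S r) y x = x - y) \<and>
    (\<forall>c\<le>y. rk (row_state m S r) y (y + r - c) = r - lcs P r c)"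
proof (induction r)
  case 0
  show ?case by (simp add: rk_id del: id_apply)
next
  case (Suc r)
  define V W where "V = row_state m S r" and "W = row_state m S (Suc r)"
  have IH: "\<And>x. y + r \<le> x \<Longrightarrow> rk V y x = x - y"
    "\<And>c. c \<le> y \<Longrightarrow> rk V y (y + r - c) = r - lcs P r c"
    using Suc unfolding V_def by blast+
  have row: "rk W y x = (if (Suc r, x) \<in> S
      then min (rk V y (x - 1) + 1) (rk W y (Suc x)) else rk V y x)" for x
    using rk_row[of "Suc r" V "\<lambda>t. (Suc r, t) \<in> S" m y x] S
    unfolding V_def W_def by (auto simp: set_cells)
  have mono: "rk V y x \<le> rk W y x" for x
    unfolding V_def W_def by (simp add: rk_foldl_mono)
  have large: "rk W y x = x - y" if "y + Suc r \<le> x" for x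
  proof -
    have "rk V y x = x - y" "rk V y (x - 1) = x - 1 - y" "rk V y (Suc x) = Suc x - y"
      using IH(1) that by auto
    moreover from this have "x - y \<le> rk W y (Suc x)" using mono[of "Suc x"] by linarith
    moreover have "x - 1 - y + 1 = x - y" using that by simp
    ultimately show ?thesis using row[of x] by (metis min_absorb1)
  qed
  have "rk W y (y + Suc r - c) = Suc r - lcs P (Suc r) c" if "c \<le> y" for c
    using that
  proof (induction c)
    case 0
    show ?case using large[of "y + Suc r"] by simp
  next
    case (Suc c)
    have V: "rk V y (y + r - Suc c) = r - lcs P r (Suc c)" "rk V y (y + r - c) = r - lcs P r c"
      using IH(2) Suc.prems by auto
    have W: "rk W y (y + Suc r - c) = Suc r - lcs P (Suc r) c" using Suc by simp
    have x: "y + Suc r - Suc c = y + r - c" "y + r - c - 1 = y + r - Suc c"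
      "Suc (y + r - c) = y + Suc r - c" using Suc.prems by auto
    show ?case
    proof (cases "P r c")
      case True
      then have "rk W y (y + r - c) = r - lcs P r c"
        using row[of "y + r - c"] V unfolding P_def by simp
      then show ?thesis using True x by simp
    next
      case False
      then have "(Suc r, y + r - c) \<in> S" by (simp add: P_def)
      then have "rk W y (y + r - c)
          = min (rk V y (y + r - c - 1) + 1) (rk W y (Suc (y + r - c)))"
        using row[of "y + r - c"] by presburger
      also have "\<dots> = min (r - lcs P r (Suc c) + 1) (Suc r - lcs P (Suc r) c)"
        unfolding x V W ..
      also have "\<dots> = Suc r - lcs P (Suc r) (Suc c)"
        using False lcs_le[of P r "Suc c"] lcs_le[of P "Suc r" c] by auto
      finally show ?thesis unfolding x .
    qed
  qed
  with large show ?case unfolding W_def[symmetric] by blast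
qed

text \<open>Later rows only contain letters \<open>t > x\<close>, which do not affect the rank at \<open>x\<close>.\<close>
lemma rk_row_state_stable:
  assumes "x \<le> r"
  shows "rk (row_state m S (r + d)) y x = rk (row_state m S r) y x"
proof (induction d)
  case (Suc d)
  then show ?case using rk_row[of "Suc (r + d)" "row_state m S (r + d)" "\<lambda>t. (Suc (r + d), t) \<in> S" m y x] assms
    by simp
qed simp

lemma rk_demazure_subword:
  assumes "S \<subseteq> set (cells m)" "x < m"
  shows "rk (demazure (subword m S)) y x = x - lcs (missing S y) x y"
proof -
  have "rk (demazure (subword m S)) y x = rk (row_state m S x) y x"
    using rk_row_state_stable[of x x m S "m - 1 - x" y] assms(2) by (simp add: row_state_eq)
  then show ?thesis using rk_row_state[OF assms(1), of y x] by auto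
qed

section \<open>The permutation \<open>1\<^sup>k \<times> w\<^sub>0\<close>\<close>

lemma pi_pi: "pi_perm k m (pi_perm k m i) = i"
  by (auto simp: pi_perm_def)

lemma pi_permutes: "pi_perm k m permutes {1..m}"
proof (rule bij_imp_permutes)
  show "bij_betw (pi_perm k m) {1..m} {1..m}"
    by (rule bij_betwI[of _ _ _ "pi_perm k m"]) (auto simp: pi_pi pi_perm_def)
qed (auto simp: pi_perm_def)

text \<open>Among the permutations that fix \<open>1, \<dots>, k\<close>, the permutation \<open>1\<^sup>k \<times> w\<^sub>0\<close> is the one with the
  largest ranks, and the ranks on the antidiagonal of \<open>w\<^sub>0\<close> already characterise it.\<close>
lemma eq_pi_iff:
  assumes v: "v permutes {1..m}" and fixed: "\<And>a. a \<le> k \<Longrightarrow> v a = a" and "k \<le> m"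
  shows "v = pi_perm k m \<longleftrightarrow> (\<forall>x\<in>{k+1..<m}. x - k \<le> rk v (m + k - x) x)"
proof
  have "x - k = rk (pi_perm k m) (m + k - x) x" if "x \<in> {k+1..<m}" for x
  proof -
    have "rk (pi_perm k m) (m + k - x) x = (\<Sum>a\<in>{1..x}. of_bool (a \<in> {k+1..x}))"
      unfolding rk_def using that by (intro sum.cong) (auto simp: pi_perm_def)
    also have "\<dots> = card ({1..x} \<inter> {k+1..x})"
      by (simp add: of_bool_def sum.If_cases del: atLeastAtMost_iff)
    also have "{1..x} \<inter> {k+1..x} = {k+1..x}" by auto
    finally show ?thesis by simp
  qed
  then show "v = pi_perm k m \<Longrightarrow> \<forall>x\<in>{k+1..<m}. x - k \<le> rk v (m + k - x) x" by simp
next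
  assume rank: "\<forall>x\<in>{k+1..<m}. x - k \<le> rk v (m + k - x) x"
  have ge: "pi_perm k m a \<le> v a" if "a \<in> {1..m}" for a
  proof (cases "a \<le> k")
    case True
    then show ?thesis using fixed by (simp add: pi_perm_def)
  next
    case a: False
    have inj: "inj v" by (rule permutes_inj[OF v])
    show ?thesis
    proof (cases "a = m")
      case True
      have "\<not> v a \<le> k"
      proof
        assume "v a \<le> k"
        then have "v (v a) = v a" by (rule fixed)
        then show False using inj a \<open>v a \<le> k\<close> by (simp add: inj_eq)
      qed
      then show ?thesis using True a by (simp add: pi_perm_def)
    next
      case False
      let ?y = "m + k - a"
      have r: "a - k \<le> rk v ?y a" using rank a False that by auto
      have "rk v ?y a = card {b \<in> {1..a}. ?y < v b}"
        unfolding rk_def by (simp add: of_bool_def sum.If_cases Int_def)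
      moreover have sub: "{b \<in> {1..a}. ?y < v b} \<subseteq> {k+1..a}"
        using fixed that by (force simp: not_less_eq_eq[symmetric])
      ultimately have "card {k+1..a} \<le> card {b \<in> {1..a}. ?y < v b}" using r by simp
      from card_seteq[OF _ sub this] have "{b \<in> {1..a}. ?y < v b} = {k+1..a}" by simp
      moreover have "a \<in> {k+1..a}" using a by simp
      ultimately have "?y < v a" by blast
      then show ?thesis using a that by (simp add: pi_perm_def)
    qed
  qed
  have id: "v \<circ> pi_perm k m = id"
  proof (rule permutes_natset_ge)
    show "v \<circ> pi_perm k m permutes {1..m}" by (rule permutes_compose[OF pi_permutes v])
    show "\<forall>i\<in>{1..m}. i \<le> (v \<circ> pi_perm k m) i"
      using ge permutes_in_image[OF pi_permutes] pi_pi by (metis comp_apply)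
  qed
  show "v = pi_perm k m"
  proof
    fix i
    show "v i = pi_perm k m i" using fun_cong[OF id, of "pi_perm k m i"] by (simp add: pi_pi)
  qed
qed

lemma foldl_dem_fixes:
  "(\<And>t. t \<in> set us \<Longrightarrow> k < t) \<Longrightarrow> a \<le> k \<Longrightarrow> foldl dem v us a = v a"
proof (induction us arbitrary: v)
  case (Cons t us)
  then have "foldl dem v (t # us) a = dem v t a" "k < t" by auto
  moreover have "dem v t a = v a" using \<open>k < t\<close> Cons.prems(2) by (simp add: dem_def transpose_def)
  ultimately show ?case by simp
qed simp

text \<open>A letter \<open>t \<le> k\<close> creates a positive rank at \<open>(t, t)\<close>, which never decreases again.\<close>
lemma pi_letters:
  assumes "demazure us = pi_perm k m" "0 \<notin> set us" "t \<in> set us"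
  shows "k < t"
proof (rule ccontr)
  assume "\<not> k < t"
  obtain xs ys where us: "us = xs @ t # ys" using assms(3) by (meson split_list)
  let ?v = "foldl dem id xs"
  have "1 \<le> rk id t (Suc t)" by (simp add: rk_id del: id_apply)
  also have "\<dots> \<le> rk ?v t (Suc t)" using assms(2) us by (intro rk_foldl_mono) auto
  finally have "1 \<le> rk (dem ?v t) t t" using rk_dem[of t ?v t] assms(2,3) by (cases t) auto
  also have "\<dots> \<le> rk (foldl dem (dem ?v t) ys) t t" using assms(2) us by (intro rk_foldl_mono) auto
  also have "foldl dem (dem ?v t) ys = pi_perm k m" using assms(1) us by (simp add: demazure_def)
  also have "rk (pi_perm k m) t t = rk id t t"
    using \<open>\<not> k < t\<close> by (intro rk_cong) (simp add: pi_perm_def)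
  finally show False by (simp add: rk_id del: id_apply)
qed

lemma demazure_subword_eq_pi_iff:
  assumes S: "S \<subseteq> set (cells m)" and k: "k \<le> m"
  shows "demazure (subword m S) = pi_perm k m \<longleftrightarrow> (\<forall>c\<in>S. k < snd c) \<and>
    (\<forall>x\<in>{k+1..<m}. lcs (missing S (m + k - x)) x (m + k - x) \<le> k)"
proof (cases "\<forall>c\<in>S. k < snd c")
  case True
  let ?v = "demazure (subword m S)"
  have "?v permutes {1..m}" by (rule demazure_permutes[OF subword_letters[OF S]])
  moreover have "?v a = a" if "a \<le> k" for a
    using foldl_dem_fixes[of "subword m S" k a id] True that by (auto simp: subword_def demazure_def)
  ultimately have "?v = pi_perm k m \<longleftrightarrow> (\<forall>x\<in>{k+1..<m}. x - k \<le> rk ?v (m + k - x) x)"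
    using k by (rule eq_pi_iff)
  also have "\<dots> \<longleftrightarrow> (\<forall>x\<in>{k+1..<m}. lcs (missing S (m + k - x)) x (m + k - x) \<le> k)"
  proof (rule ball_cong[OF refl])
    fix x assume x: "x \<in> {k+1..<m}"
    then have "x - k \<le> x - j \<longleftrightarrow> j \<le> k" if "j \<le> x" for j using that by auto
    from this[OF lcs_le] show "x - k \<le> rk ?v (m + k - x) x
        \<longleftrightarrow> lcs (missing S (m + k - x)) x (m + k - x) \<le> k"
      using rk_demazure_subword[OF S, of x "m + k - x"] x by (simp only: atLeastLessThan_iff)
  qed
  finally show ?thesis using True by blast
next
  case False
  have "set (subword m S) \<subseteq> {1..<m}" by (rule subword_letters[OF S])
  moreover have "set (subword m S) = snd ` S" using S by (auto simp: subword_def)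
  ultimately have "demazure (subword m S) \<noteq> pi_perm k m"
    using False pi_letters[of "subword m S" k m] by force
  with False show ?thesis by blast
qed


section \<open>Counting diagonals and inversions\<close>

text \<open>The diagonal of the cell \<open>(i, t)\<close>. Vertices count from \<open>0\<close>, so row \<open>i\<close> starts at the vertex
  \<open>i - 1\<close>, and the letter \<open>t\<close> gives the length \<open>N - t\<close>.\<close>
definition chord :: "nat \<Rightarrow> nat \<times> nat \<Rightarrow> nat set" where
  "chord N c = {fst c - 1, fst c - 1 + N - snd c}"

lemma chord_eq: "t \<le> N \<Longrightarrow> chord N (Suc a, t) = {a, a + (N - t)}"
  by (simp add: chord_def)

lemma pair_set_eq_iff: "a < b \<Longrightarrow> a' < b' \<Longrightarrow> {a, b} = {a', b'} \<longleftrightarrow> a = a' \<and> b = (b' :: nat)"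
  by (auto simp: doubleton_eq_iff)

lemma inj_on_pair_set: "inj_on (\<lambda>(a, b). {a, b}) {(a, b). a < (b :: nat)}"
  by (auto simp: inj_on_def pair_set_eq_iff)

lemma diagonal_iff: "a < b \<Longrightarrow> {a, b} \<in> diagonals N \<longleftrightarrow> b < N \<and> 2 \<le> b - a \<and> b - a + 2 \<le> N"
proof -
  assume ab: "a < b"
  have "{a, b} \<in> diagonals N \<longleftrightarrow> (\<exists>i j. {a, b} = {i, j} \<and> i < N \<and> j < N \<and> 2 \<le> bdist N i j)"
    by (simp add: diagonals_def)
  also have "\<dots> \<longleftrightarrow> a < N \<and> b < N \<and> 2 \<le> bdist N a b"
  proof -
    have "bdist N b a = bdist N a b" by (auto simp: bdist_def Let_def)
    then show ?thesis by (auto simp: doubleton_eq_iff)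
  qed
  also have "\<dots> \<longleftrightarrow> b < N \<and> 2 \<le> b - a \<and> b - a + 2 \<le> N"
    using ab by (auto simp: bdist_def Let_def)
  finally show ?thesis .
qed

lemma diagonal_cases:
  assumes "d \<in> diagonals N"
  obtains a b where "d = {a, b}" "a < b" "b < N" "2 \<le> b - a" "b - a + 2 \<le> N"
proof -
  obtain i j where d: "d = {i, j}" "2 \<le> bdist N i j" using assms by (auto simp: diagonals_def)
  have "i \<noteq> j" using d(2) by (auto simp: bdist_def)
  then consider "i < j" | "j < i" by linarith
  then show thesis
  proof cases
    case 1
    then show thesis using that[of i j] assms d(1) diagonal_iff[of i j N] by auto
  next
    case 2
    then show thesis using that[of j i] assms d(1) diagonal_iff[of j i N] by (auto simp: insert_commute)
  qed
qed

lemma card_diagonals: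
  assumes "3 \<le> N"
  shows "2 * card (diagonals N) + 3 * N = N * N"
proof -
  define D where "D N = {(a, b). a < b \<and> b < N \<and> 2 \<le> b - a \<and> b - a + 2 \<le> N}" for N :: nat
  have "diagonals N = (\<lambda>(a, b). {a, b}) ` D N"
    by (auto simp: D_def diagonal_iff image_iff elim!: diagonal_cases)
  moreover have "inj_on (\<lambda>(a, b). {a, b}) (D N)"
    by (rule inj_on_subset[OF inj_on_pair_set]) (auto simp: D_def)
  ultimately have card: "card (diagonals N) = card (D N)" by (simp add: card_image)
  have fin: "finite (D M)" for M
    by (rule finite_subset[of _ "{..<M} \<times> {..<M}"]) (auto simp: D_def)
  have "2 * card (D N) + 3 * N = N * N"
    using assms
  proof (induction N rule: dec_induct)
    case base
    have "D 3 = {}" by (auto simp: D_def)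
    then show ?case by simp
  next
    case (step N)
    have "D (Suc N) = insert (0, N - 1) (D N \<union> (\<lambda>a. (a, N)) ` {1..N - 2})"
      using step.hyps by (auto simp: D_def image_iff)
    moreover have "(0, N - 1) \<notin> D N \<union> (\<lambda>a. (a, N)) ` {1..N - 2}"
      using step.hyps by (auto simp: D_def)
    moreover have "card (D N \<union> (\<lambda>a. (a, N)) ` {1..N - 2}) = card (D N) + (N - 2)"
    proof (subst card_Un_disjoint[OF fin])
      show "D N \<inter> (\<lambda>a. (a, N)) ` {1..N - 2} = {}" by (auto simp: D_def)
    qed (simp_all add: card_image inj_on_def)
    ultimately have "card (D (Suc N)) = card (D N) + (N - 2) + 1" using fin by simp
    then show ?case using step by (simp add: algebra_simps)
  qed
  with card show ?thesis by simp
qed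

lemma ell_pi:
  assumes "k \<le> m"
  shows "2 * ell (pi_perm k m) + (m - k) = (m - k) * (m - k)"
proof -
  define I where "I m = {(a, b). k < a \<and> a < b \<and> b \<le> m}" for m
  have fin: "finite (I m)" for m
    by (rule finite_subset[of _ "{..m} \<times> {..m}"]) (auto simp: I_def)
  have "inversions (pi_perm k m) = I m"
    by (auto simp: inversions_def pi_perm_def I_def split: if_splits)
  moreover have "2 * card (I m) + (m - k) = (m - k) * (m - k)"
    using assms
  proof (induction m rule: dec_induct)
    case base
    have "I k = {}" by (auto simp: I_def)
    then show ?case by simp
  next
    case (step m)
    have "I (Suc m) = I m \<union> (\<lambda>a. (a, Suc m)) ` {k+1..m}"
      by (auto simp: I_def)
    moreover have "card (I m \<union> (\<lambda>a. (a, Suc m)) ` {k+1..m}) = card (I m) + (m - k)"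
    proof (subst card_Un_disjoint[OF fin])
      show "I m \<inter> (\<lambda>a. (a, Suc m)) ` {k+1..m} = {}" by (auto simp: I_def)
    qed (simp_all add: card_image inj_on_def)
    ultimately have "card (I (Suc m)) = card (I m) + (m - k)" by simp
    moreover obtain d where "m = k + d" using step.hyps le_Suc_ex by blast
    ultimately show ?case using step.IH by simp
  qed
  ultimately show ?thesis by (simp add: ell_def)
qed

lemma crosses_iff:
  assumes "a < b" "a' < b'"
  shows "crosses {a, b} {a', b'} \<longleftrightarrow> (a < a' \<and> a' < b \<and> b < b') \<or> (a' < a \<and> a < b' \<and> b' < b)"
proof
  assume "crosses {a, b} {a', b'}"
  then obtain p q r s where o: "p < q" "q < r" "r < s"
    and "{a, b} = {p, r} \<and> {a', b'} = {q, s} \<or> {a, b} = {q, s} \<and> {a', b'} = {p, r}"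
    unfolding crosses_def by blast
  then show "(a < a' \<and> a' < b \<and> b < b') \<or> (a' < a \<and> a < b' \<and> b' < b)"
    using assms pair_set_eq_iff[OF assms(1), of p r] pair_set_eq_iff[OF assms(1), of q s]
      pair_set_eq_iff[OF assms(2), of p r] pair_set_eq_iff[OF assms(2), of q s] by auto
next
  assume "(a < a' \<and> a' < b \<and> b < b') \<or> (a' < a \<and> a < b' \<and> b' < b)"
  then show "crosses {a, b} {a', b'}" unfolding crosses_def by blast
qed

section \<open>Crossing families and chains\<close>

text \<open>In a crossing family the larger end points all lie beyond the largest of the smaller end
  points, \<open>A\<close>. The family is therefore a chain in the grid with the rows \<open>0, \<dots>, A\<close> and the columns
  \<open>A + 1, \<dots>, N - 1\<close>, which is the grid for \<open>x = A + 1\<close>.\<close>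
lemma crossing_family_imp_chain:
  fixes C :: "nat set set" and S :: "(nat \<times> nat) set"
  assumes N: "N = m + k" and C: "C \<subseteq> diagonals N - chord N ` S" "card C = k + 1" "pairwise crosses C"
  shows "\<exists>x\<in>{k+1..<m}. k + 1 \<le> lcs (missing S (m + k - x)) x (m + k - x)"
proof -
  define Q where "Q = {(a, b). a < b \<and> {a, b} \<in> C}"
  have CQ: "C = (\<lambda>(a, b). {a, b}) ` Q"
  proof (intro equalityI subsetI)
    fix d assume "d \<in> C"
    then obtain a b where "d = {a, b}" "a < b" using C(1) diagonal_cases by (metis DiffD1 subsetD)
    then show "d \<in> (\<lambda>(a, b). {a, b}) ` Q" using \<open>d \<in> C\<close> by (auto simp: Q_def image_iff)
  qed (auto simp: Q_def)
  have "inj_on (\<lambda>(a, b). {a, b}) Q"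
    by (rule inj_on_subset[OF inj_on_pair_set]) (auto simp: Q_def)
  then have cardQ: "card Q = k + 1" using C(2) by (simp add: CQ card_image)
  have finQ: "finite Q" "Q \<noteq> {}" using cardQ by (auto intro: card_ge_0_finite)
  have Q: "a < b" "b < N" "{a, b} \<in> C" if "(a, b) \<in> Q" for a b
  proof -
    show *: "a < b" "{a, b} \<in> C" using that by (auto simp: Q_def)
    then show "b < N" using C(1) diagonal_iff by blast
  qed
  have cross: "(a, b) = (a', b') \<or> (a < a' \<and> a' < b \<and> b < b') \<or> (a' < a \<and> a < b' \<and> b' < b)"
    if "(a, b) \<in> Q" "(a', b') \<in> Q" for a b a' b'
  proof (cases "(a, b) = (a', b')")
    case False
    then have "{a, b} \<noteq> {a', b'}" using Q(1)[OF that(1)] Q(1)[OF that(2)] by (simp add: pair_set_eq_iff)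
    then have "crosses {a, b} {a', b'}" using C(3) Q(3)[OF that(1)] Q(3)[OF that(2)]
      by (auto simp: pairwise_def)
    then show ?thesis using crosses_iff[OF Q(1)[OF that(1)] Q(1)[OF that(2)]] by blast
  qed simp
  define A where "A = Max (fst ` Q)"
  have le_A: "a \<le> A" if "(a, b) \<in> Q" for a b
    unfolding A_def using finQ that by (intro Max_ge) (auto simp: image_iff intro: bexI[of _ "(a, b)"])
  have "A \<in> fst ` Q" unfolding A_def using finQ by (intro Max_in) auto
  then obtain B where AB: "(A, B) \<in> Q" by auto
  have A_less: "A < b" if "(a, b) \<in> Q" for a b
    using cross[OF AB that] le_A[OF that] Q(1)[OF AB] by auto
  define x where "x = Suc A"
  define C' where "C' = (\<lambda>(a, b). (a, b - x)) ` Q"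
  have "inj_on (\<lambda>(a, b). (a, b - x)) Q"
    using cross by (fastforce simp: inj_on_def)
  then have card: "card C' = k + 1" using cardQ by (simp add: C'_def card_image)
  have sub: "C' \<subseteq> box (missing S (m + k - x)) x (m + k - x)"
  proof
    fix p assume "p \<in> C'"
    then obtain a b where p: "p = (a, b - x)" and ab: "(a, b) \<in> Q" by (auto simp: C'_def)
    have lt: "a < x" "x \<le> b" "b < N"
      using le_A[OF ab] A_less[OF ab] Q(2)[OF ab] by (auto simp: x_def)
    have "{a, b} \<notin> chord N ` S" using C(1) Q(3)[OF ab] by blast
    moreover have "chord N (Suc a, m + k - x + a - (b - x)) = {a, b}"
      using lt by (subst chord_eq) (auto simp: N)
    ultimately have "(Suc a, m + k - x + a - (b - x)) \<notin> S" by (metis image_eqI)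
    then show "p \<in> box (missing S (m + k - x)) x (m + k - x)"
      using lt by (simp add: box_def p N)
  qed
  have "is_chain C'"
  proof -
    have "p = q \<or> (fst p < fst q \<and> snd p < snd q) \<or> (fst q < fst p \<and> snd q < snd p)"
      if pq: "p \<in> C'" "q \<in> C'" for p q
    proof -
      obtain a b where p: "p = (a, b - x)" "(a, b) \<in> Q" using pq(1) by (auto simp: C'_def)
      obtain a' b' where q: "q = (a', b' - x)" "(a', b') \<in> Q" using pq(2) by (auto simp: C'_def)
      show ?thesis using cross[OF p(2) q(2)] A_less[OF p(2)] A_less[OF q(2)] p(1) q(1)
        by (auto simp: x_def)
    qed
    then show ?thesis unfolding is_chain_def by blast
  qed
  then have "k + 1 \<le> lcs (missing S (m + k - x)) x (m + k - x)"
    using card_chain_le[OF _ sub] card by simp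
  \<comment> \<open>The \<open>k + 1\<close> smaller end points are distinct, and so are the larger ones; this bounds \<open>x\<close> from both sides.\<close>
  moreover have "k + 1 \<le> x"
  proof -
    have "inj_on fst Q" using cross by (fastforce simp: inj_on_def)
    then have "card (fst ` Q) = k + 1" using cardQ by (simp add: card_image)
    moreover have "card (fst ` Q) \<le> card {..A}" using le_A by (intro card_mono) auto
    ultimately show ?thesis by (simp add: x_def)
  qed
  moreover have "x < m"
  proof -
    have "inj_on snd Q" using cross by (fastforce simp: inj_on_def)
    then have "card (snd ` Q) = k + 1" using cardQ by (simp add: card_image)
    moreover have "card (snd ` Q) \<le> card {x..<N}" using A_less Q(2) by (intro card_mono) (auto simp: x_def Suc_le_eq)
    ultimately show ?thesis by (simp add: N)
  qed
  ultimately show ?thesis by auto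
qed

lemma chain_imp_crossing_family:
  fixes S :: "(nat \<times> nat) set"
  assumes N: "N = m + k" and k: "1 \<le> k" and S: "S \<subseteq> set (cells m)" and x: "x < m"
    and lcs: "k + 1 \<le> lcs (missing S (m + k - x)) x (m + k - x)"
  shows "\<exists>C\<subseteq>diagonals N - chord N ` S. card C = k + 1 \<and> pairwise crosses C"
proof -
  obtain Q where Q: "is_chain Q" "Q \<subseteq> box (missing S (m + k - x)) x (m + k - x)"
    "card Q = k + 1"
    using lcs unfolding ex_chain_card_iff[symmetric] by blast
  let ?d = "\<lambda>(r, c). {r, x + c}"
  have box: "r < x" "x + c < N" "(Suc r, m + k - x + r - c) \<notin> S" if "(r, c) \<in> Q" for r c
    using Q(2) that by (auto simp: box_def N)
  have chain: "(r, c) = (r', c') \<or> (r < r' \<and> c < c') \<or> (r' < r \<and> c' < c)"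
    if "(r, c) \<in> Q" "(r', c') \<in> Q" for r c r' c'
    using bspec[OF bspec[OF Q(1)[unfolded is_chain_def] that(1)] that(2)] by auto
  have "inj_on ?d Q"
  proof (rule inj_onI, clarify)
    fix r c r' c' assume "(r, c) \<in> Q" "(r', c') \<in> Q" "{r, x + c} = {r', x + c'}"
    then show "r = r' \<and> c = c'"
      using pair_set_eq_iff[of r "x + c" r' "x + c'"] box(1)[of r c] box(1)[of r' c'] by auto
  qed
  then have "card (?d ` Q) = k + 1" using Q(3) by (simp add: card_image)
  moreover have "pairwise crosses (?d ` Q)"
  proof (clarsimp simp: pairwise_def)
    fix r c r' c' assume a: "(r, c) \<in> Q" "(r', c') \<in> Q" "{r, x + c} \<noteq> {r', x + c'}"
    then show "crosses {r, x + c} {r', x + c'}"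
      using chain[OF a(1,2)] box(1)[OF a(1)] box(1)[OF a(2)] by (subst crosses_iff) auto
  qed
  moreover have "?d ` Q \<subseteq> diagonals N - chord N ` S"
  proof (clarify, intro DiffI)
    fix r c assume rc: "(r, c) \<in> Q"
    \<comment> \<open>A chord that crosses another one is not a side, and \<open>k + 1 \<ge> 2\<close> chords are available.\<close>
    have "Q - {(r, c)} \<noteq> {}"
    proof
      assume "Q - {(r, c)} = {}"
      then have "card Q \<le> card {(r, c)}" by (intro card_mono) auto
      then show False using Q(3) k by simp
    qed
    then obtain r' c' where rc': "(r', c') \<in> Q" "(r', c') \<noteq> (r, c)" by auto
    show "{r, x + c} \<in> diagonals N"
      using chain[OF rc rc'(1)] rc'(2) box[OF rc] box[OF rc'(1)]
      by (subst diagonal_iff) auto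
    show "{r, x + c} \<notin> chord N ` S"
    proof
      assume "{r, x + c} \<in> chord N ` S"
      then obtain i t where it: "(i, t) \<in> S" "{r, x + c} = chord N (i, t)" by auto
      then obtain a where a: "i = Suc a" "t < N" using S N by (cases i) (auto simp: set_cells)
      then have "r = a \<and> x + c = a + (N - t)"
        using it(2) box(1)[OF rc] pair_set_eq_iff[of r "x + c" a "a + (N - t)"] by (simp add: chord_eq)
      then have "(i, t) = (Suc r, m + k - x + r - c)"
        using a x box(2)[OF rc] by (auto simp: N)
      then show False using it(1) box(3)[OF rc] by simp
    qed
  qed
  ultimately show ?thesis by blast
qed

section \<open>Dissections and subwords\<close>

lemma chord_cell:
  assumes "(i, t) \<in> set (cells m)" "N = m + k"
  shows "chord N (i, t) = {i - 1, i - 1 + (N - t)}" "i - 1 + (N - t) < N" "k < N - t"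
  using assms by (auto simp: chord_def set_cells)

lemma inj_on_chord:
  assumes N: "N = m + k"
  shows "inj_on (chord N) (set (cells m))"
proof (rule inj_onI, unfold split_paired_all)
  fix i t i' t' assume c: "(i, t) \<in> set (cells m)" "(i', t') \<in> set (cells m)"
    and eq: "chord N (i, t) = chord N (i', t')"
  have lt: "i - 1 < i - 1 + (N - t)" "i' - 1 < i' - 1 + (N - t')"
    using chord_cell(3)[OF c(1) N] chord_cell(3)[OF c(2) N] by auto
  have "i - 1 = i' - 1 \<and> i - 1 + (N - t) = i' - 1 + (N - t')"
    using eq unfolding chord_cell(1)[OF c(1) N] chord_cell(1)[OF c(2) N] pair_set_eq_iff[OF lt] .
  then show "(i, t) = (i', t')" using c N by (auto simp: set_cells)
qed

lemma chord_diagonal: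
  assumes "c \<in> set (cells m)" "N = m + k" "1 \<le> k" "k < snd c"
  shows "chord N c \<in> diagonals N"
proof -
  obtain i t where c: "c = (i, t)" by (cases c)
  show ?thesis unfolding c chord_cell(1)[OF assms(1)[unfolded c] assms(2)]
    using chord_cell(2,3)[OF assms(1)[unfolded c] assms(2)] assms(2-4) c
    by (subst diagonal_iff) auto
qed

lemma chord_not_short:
  assumes "(i, t) \<in> set (cells m)" "N = m + k" "k < t" "chord N (i, t) = {v, u}" "v < N" "u < N"
  shows "k < bdist N v u"
proof -
  have "{v, u} = {i - 1, i - 1 + (N - t)}" using assms(4) chord_cell(1)[OF assms(1,2)] by simp
  then have "v = i - 1 \<and> u = i - 1 + (N - t) \<or> u = i - 1 \<and> v = i - 1 + (N - t)"
    by (auto simp: doubleton_eq_iff)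
  then show ?thesis using chord_cell(2,3)[OF assms(1,2)] assms(1-3) by (auto simp: bdist_def Let_def set_cells)
qed

text \<open>Every diagonal of length greater than \<open>k\<close>, measured along the boundary, comes from a cell.\<close>
lemma long_diagonal_chord:
  assumes "a < b" "b < N" "k < bdist N a b" "N = m + k"
  obtains c where "c \<in> set (cells m)" "k < snd c" "chord N c = {a, b}"
proof
  have d: "k < b - a" "b - a + k < N" using assms(1-3) by (auto simp: bdist_def Let_def)
  show "(Suc a, N - (b - a)) \<in> set (cells m)" "k < snd (Suc a, N - (b - a))"
    using d assms by (auto simp: set_cells)
  show "chord N (Suc a, N - (b - a)) = {a, b}"
    using assms by (subst chord_eq) auto
qed

text \<open>The set \<open>S\<close> of cells used corresponds to the dissection \<open>E\<close> of all diagonals that are not chords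
  of \<open>S\<close>.\<close>
lemma sum_dissections:
  fixes g :: "nat \<Rightarrow> int poly"
  assumes k: "1 \<le> k" "k \<le> m" and N: "N = m + k"
  shows "(\<Sum>S | S \<subseteq> set (cells m) \<and> demazure (subword m S) = pi_perm k m. g (card S)) =
    (\<Sum>E\<in>k_dissections k N. g (card (diagonals N) - card E))"
proof (rule sum.reindex_bij_witness[where j = "\<lambda>S. diagonals N - chord N ` S"
      and i = "\<lambda>E. {c \<in> set (cells m). k < snd c \<and> chord N c \<notin> E}"])
  have fin_diag: "finite (diagonals N)"
    by (rule finite_subset[of _ "Pow {..<N}"]) (auto simp: diagonals_def)
  have noncross: "(\<forall>x\<in>{k+1..<m}. lcs (missing S (m + k - x)) x (m + k - x) \<le> k)
      \<longleftrightarrow> \<not> (\<exists>C\<subseteq>diagonals N - chord N ` S. card C = k + 1 \<and> pairwise crosses C)"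
    if S: "S \<subseteq> set (cells m)" for S
  proof
    assume le: "\<forall>x\<in>{k+1..<m}. lcs (missing S (m + k - x)) x (m + k - x) \<le> k"
    show "\<not> (\<exists>C\<subseteq>diagonals N - chord N ` S. card C = k + 1 \<and> pairwise crosses C)"
    proof clarify
      fix C assume "C \<subseteq> diagonals N - chord N ` S" "card C = k + 1" "pairwise crosses C"
      from crossing_family_imp_chain[OF N this] obtain x where x: "x \<in> {k+1..<m}"
        and "k + 1 \<le> lcs (missing S (m + k - x)) x (m + k - x)" by blast
      with bspec[OF le x] show False by linarith
    qed
  next
    assume nc: "\<not> (\<exists>C\<subseteq>diagonals N - chord N ` S. card C = k + 1 \<and> pairwise crosses C)"
    show "\<forall>x\<in>{k+1..<m}. lcs (missing S (m + k - x)) x (m + k - x) \<le> k"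
    proof (rule ballI, rule ccontr)
      fix x assume "x \<in> {k+1..<m}"
        and "\<not> lcs (missing S (m + k - x)) x (m + k - x) \<le> k"
      then have "x < m" "k + 1 \<le> lcs (missing S (m + k - x)) x (m + k - x)"
        by simp_all
      from chain_imp_crossing_family[OF N k(1) S this] nc show False by blast
    qed
  qed
  {
    fix S assume "S \<in> {S. S \<subseteq> set (cells m) \<and> demazure (subword m S) = pi_perm k m}"
    then have S: "S \<subseteq> set (cells m)" and "demazure (subword m S) = pi_perm k m" by auto
    then have large: "\<forall>c\<in>S. k < snd c"
      and nc: "\<not> (\<exists>C\<subseteq>diagonals N - chord N ` S. card C = k + 1 \<and> pairwise crosses C)"
      using demazure_subword_eq_pi_iff[OF S k(2)] noncross[OF S] by auto
    have mem: "chord N c \<in> chord N ` S \<longleftrightarrow> c \<in> S" if "c \<in> set (cells m)" for c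
      using inj_on_image_mem_iff[OF inj_on_chord[OF N] that S] .
    have diag: "chord N c \<in> diagonals N" if "c \<in> set (cells m)" "k < snd c" for c
      using chord_diagonal[OF that(1) N k(1) that(2)] .
    show "{c \<in> set (cells m). k < snd c \<and> chord N c \<notin> diagonals N - chord N ` S} = S"
      using mem diag large S by blast
    show "diagonals N - chord N ` S \<in> k_dissections k N"
    proof -
      have "{v, u} \<in> diagonals N - chord N ` S"
        if "v < N" "u < N" "2 \<le> bdist N v u" "bdist N v u \<le> k" for v u
      proof (rule DiffI)
        show "{v, u} \<in> diagonals N" using that unfolding diagonals_def by blast
        show "{v, u} \<notin> chord N ` S"
        proof
          assume "{v, u} \<in> chord N ` S"
          then obtain i t where "(i, t) \<in> S" "chord N (i, t) = {v, u}" by auto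
          then show False using chord_not_short[of i t m N k v u] S large N that by force
        qed
      qed
      then show ?thesis using nc unfolding k_dissections_def by blast
    qed
    have sub: "chord N ` S \<subseteq> diagonals N" using diag large S by blast
    have "card (chord N ` S) = card S"
      using inj_on_subset[OF inj_on_chord[OF N] S] by (rule card_image)
    moreover have "card (diagonals N - chord N ` S) = card (diagonals N) - card (chord N ` S)"
      using sub fin_diag finite_subset by (intro card_Diff_subset) auto
    moreover have "card (chord N ` S) \<le> card (diagonals N)" by (rule card_mono[OF fin_diag sub])
    ultimately show "g (card (diagonals N) - card (diagonals N - chord N ` S)) = g (card S)" by simp
  }
  {
    fix E assume "E \<in> k_dissections k N"
    then have E: "E \<subseteq> diagonals N" "\<not> (\<exists>C\<subseteq>E. card C = k + 1 \<and> pairwise crosses C)"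
      "\<And>v u. v < N \<Longrightarrow> u < N \<Longrightarrow> 2 \<le> bdist N v u \<Longrightarrow> bdist N v u \<le> k \<Longrightarrow> {v, u} \<in> E"
      unfolding k_dissections_def by auto
    let ?S = "{c \<in> set (cells m). k < snd c \<and> chord N c \<notin> E}"
    show eq: "diagonals N - chord N ` ?S = E"
    proof (intro equalityI subsetI)
      fix d assume d: "d \<in> diagonals N - chord N ` ?S"
      then obtain a b where ab: "d = {a, b}" "a < b" "b < N" "2 \<le> b - a" "b - a + 2 \<le> N"
        using diagonal_cases by blast
      show "d \<in> E"
      proof (cases "bdist N a b \<le> k")
        case True
        moreover have "2 \<le> bdist N a b" using ab by (auto simp: bdist_def Let_def)
        ultimately show ?thesis using E(3)[of a b] ab by simp
      next
        case False
        then have "k < bdist N a b" by simp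
        then obtain c where c: "c \<in> set (cells m)" "k < snd c" "chord N c = {a, b}"
          by (rule long_diagonal_chord[OF ab(2,3) _ N])
        show ?thesis
        proof (rule ccontr)
          assume "d \<notin> E"
          then have "c \<in> ?S" using c ab(1) by simp
          then have "d \<in> chord N ` ?S" using c(3) ab(1) by (intro image_eqI[of _ _ c]) simp_all
          then show False by (rule DiffD2[OF d])
        qed
      qed
    qed (use E(1) in blast)
    have S: "?S \<subseteq> set (cells m)" by blast
    have "demazure (subword m ?S) = pi_perm k m"
      unfolding demazure_subword_eq_pi_iff[OF S k(2)] noncross[OF S] eq using E(2) by blast
    then show "?S \<in> {S. S \<subseteq> set (cells m) \<and> demazure (subword m S) = pi_perm k m}"
      using S by blast
  }
qed

text \<open>The index of a dissection is the number of diagonals that it omits, minus the length of the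
  permutation. For the \<open>2\<close>-gon both are \<open>0\<close>.\<close>
lemma index_eq:
  assumes k: "1 \<le> k" "k \<le> n + 1" and N: "N = n + k + 1" and E: "E \<subseteq> diagonals N"
  shows "dissection_index k n E = card (diagonals N) - card E - ell (pi_perm k (n + 1))"
proof (cases "n = 0")
  case True
  \<comment> \<open>Here \<open>k = 1\<close>, and the polygon is a \<open>2\<close>-gon without diagonals.\<close>
  then have "N = 2" using k N by simp
  then have "diagonals N = {}" by (auto elim!: diagonal_cases)
  then show ?thesis using True by (simp add: dissection_index_def)
next
  case False
  have fin: "finite (diagonals N)"
    by (rule finite_subset[of _ "Pow {..<N}"]) (auto simp: diagonals_def)
  obtain j where j: "k = Suc j" using k(1) by (cases k) auto
  define d where "d = n + 1 - k"
  have n: "n = j + d" using k j by (simp add: d_def)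
  have "2 * card (diagonals N) + 3 * N = N * N" using False k(1) N by (intro card_diagonals) simp
  moreover have "2 * ell (pi_perm k (n + 1)) + d = d * d" using ell_pi[OF k(2)] by (simp add: d_def)
  moreover have "N = 2 * j + d + 2" using N n j by simp
  \<comment> \<open>With \<open>n = j + d\<close> and \<open>N = 2 j + d + 2\<close> this is a polynomial identity in \<open>j\<close> and \<open>d\<close>.\<close>
  ultimately have "2 * (n * (2 * k - 1)) + 2 * ell (pi_perm k (n + 1)) = 2 * card (diagonals N) + 2"
    by (simp add: n j algebra_simps)
  then have "n * (2 * k - 1) + ell (pi_perm k (n + 1)) = card (diagonals N) + 1" by simp
  moreover have "1 \<le> n * (2 * k - 1)" using False k(1) by (cases n) auto
  moreover have "card E \<le> card (diagonals N)" by (rule card_mono[OF fin E])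
  ultimately show ?thesis unfolding dissection_index_def by linarith
qed

theorem theorem5p5:
  fixes k n :: nat
  assumes "k \<ge> 1" and "n + 1 \<ge> k"
  shows "xeval (\<lambda>_. 1) (grothendieck (n + 1) (pi_perm k (n + 1))) = T_poly k n"
proof -
  let ?m = "n + 1" and ?N = "n + k + 1"
  let ?l = "ell (pi_perm k ?m)"
  have "xeval (\<lambda>_. 1) (grothendieck ?m (pi_perm k ?m))
      = (\<Sum>S | S \<subseteq> set (cells ?m) \<and> demazure (subword ?m S) = pi_perm k ?m. beta ^ (card S - ?l))"
    by (rule xeval_grothendieck[OF pi_permutes])
  also have "\<dots> = (\<Sum>E\<in>k_dissections k ?N. beta ^ (card (diagonals ?N) - card E - ?l))"
    using assms by (intro sum_dissections) auto
  also have "\<dots> = (\<Sum>E\<in>k_dissections k ?N. beta ^ dissection_index k n E)"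
  proof (rule sum.cong[OF refl])
    fix E assume "E \<in> k_dissections k ?N"
    then have "E \<subseteq> diagonals ?N" unfolding k_dissections_def by blast
    then show "beta ^ (card (diagonals ?N) - card E - ?l) = beta ^ dissection_index k n E"
      using index_eq[OF assms(1) _ refl] assms(2) by simp
  qed
  finally show ?thesis unfolding T_poly_def .
qed

end
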